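(* Let $n\ge 2$, let $0<r_1<\ldots<r_n$ and $\rho:=\{r_1,\ldots,r_n\}$, and let $\nu_1,\ldots,\nu_n$ be arbitrary real values. For each integer $k\neq 0$, there exists a unique Beppo Levi $L_k$-spline $\sigma\in\mathcal{S}_k(\rho)$ such that $$\sigma(r_j)=\nu_j,\quad j\in\{1,\ldots,n\}.$$
   Context: For an integer $k\neq 0$ define the ordinary differential operators on $(0,\infty)$ $$L_k:=r\frac{d^4}{dr^4}+2\frac{d^3}{dr^3}-\frac{2k^2+1}{r}\frac{d^2}{dr^2}+\frac{2k^2+1}{r^2}\frac{d}{dr}+\frac{k^4-4k^2}{r^3}=r\left(\frac{d^2}{dr^2}+\frac1r\frac{d}{dr}-\frac{k^2}{r^2}\right)^2,$$ $$G_k:=\frac1r\left[\frac{d^2}{dr^2}-\frac{2|k|+1}{r}\frac{d}{dr}+\frac{|k|(|k|+2)}{r^2}\right],\qquad R_k:=\frac1r\left[\frac{d^2}{dr^2}+\frac{2|k|-1}{r}\frac{d}{dr}+\frac{|k|(|k|-2)}{r^2}\right].$$ The null space of $G_k$ is $\mathrm{span}\{r^{|k|+2},r^{|k|}\}$ and that of $R_k$ is $\mathrm{span}\{r^{-|k|+2},r^{-|k|}\}$. Let $\rho=\{r_1,\ldots,r_n\}$ with $0<r_1<\ldots<r_n$. A function $\eta:[0,\infty)\to\mathbb{C}$ is called a Beppo Levi $L_k$-spline on $\rho$ if: (i) $L_k\eta(r)=0$ for all $r\in(r_j,r_{j+1})$ and all $j\in\{1,\ldots,n-1\}$; (ii)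 $G_k\eta(r)=0$ for all $r\in(0,r_1)$ and $R_k\eta(r)=0$ for all $r>r_n$; (iii) $\eta$ is $C^2$-continuous at each knot $r_1,\ldots,r_n$. The value at $0$ is understood by continuity, i.e. $\eta(0)=\lim_{r\to0^+}\eta(r)=0$. The space of all Beppo Levi $L_k$-splines on $\rho$ is denoted $\mathcal{S}_k(\rho)$. *)

theory Defs
  imports "HOL-Analysis.Analysis"
begin

definition nth_vderiv :: "nat \<Rightarrow> (real \<Rightarrow> complex) \<Rightarrow> real \<Rightarrow> complex" where
  "nth_vderiv m f = ((\<lambda>g x. vector_derivative g (at x)) ^^ m) f"

text \<open>
  Since \<^const>\<open>vector_derivative\<close> is total, differentiability has to be required separately
  wherever a differential equation is imposed.
\<close>

definition times_differentiable_on :: "nat \<Rightarrow> (real \<Rightarrow> complex) \<Rightarrow> real set \<Rightarrow> bool" where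
  "times_differentiable_on m f S \<longleftrightarrow> (\<forall>i<m. \<forall>x\<in>S. nth_vderiv i f differentiable (at x))"

definition C2_at :: "(real \<Rightarrow> complex) \<Rightarrow> real \<Rightarrow> bool" where
  "C2_at f x \<longleftrightarrow>
     (\<exists>U. open U \<and> x \<in> U \<and> times_differentiable_on 2 f U \<and> continuous_on U (nth_vderiv 2 f))"

definition L_op :: "int \<Rightarrow> (real \<Rightarrow> complex) \<Rightarrow> real \<Rightarrow> complex" where
  "L_op k f r =
     r *\<^sub>R nth_vderiv 4 f r
     + 2 *\<^sub>R nth_vderiv 3 f r
     - ((2 * real_of_int k ^ 2 + 1) / r) *\<^sub>R nth_vderiv 2 f r
     + ((2 * real_of_int k ^ 2 + 1) / r ^ 2) *\<^sub>R nth_vderiv 1 f r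
     + ((real_of_int k ^ 4 - 4 * real_of_int k ^ 2) / r ^ 3) *\<^sub>R f r"

definition G_op :: "int \<Rightarrow> (real \<Rightarrow> complex) \<Rightarrow> real \<Rightarrow> complex" where
  "G_op k f r =
     (1 / r) *\<^sub>R
       (nth_vderiv 2 f r
        - ((2 * \<bar>real_of_int k\<bar> + 1) / r) *\<^sub>R nth_vderiv 1 f r
        + (\<bar>real_of_int k\<bar> * (\<bar>real_of_int k\<bar> + 2) / r ^ 2) *\<^sub>R f r)"

definition R_op :: "int \<Rightarrow> (real \<Rightarrow> complex) \<Rightarrow> real \<Rightarrow> complex" where
  "R_op k f r =
     (1 / r) *\<^sub>R
       (nth_vderiv 2 f r
        + ((2 * \<bar>real_of_int k\<bar> - 1) / r) *\<^sub>R nth_vderiv 1 f r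
        + (\<bar>real_of_int k\<bar> * (\<bar>real_of_int k\<bar> - 2) / r ^ 2) *\<^sub>R f r)"

text \<open>
  A function on \<open>[0, \<infinity>)\<close> is represented by an element of \<^term>\<open>extensional {0::real..}\<close>, so that
  equality of such functions is equality on \<open>[0, \<infinity>)\<close>. The knots are \<open>r 1 < \<dots> < r n\<close>.
\<close>

definition beppo_levi_splines :: "int \<Rightarrow> nat \<Rightarrow> (nat \<Rightarrow> real) \<Rightarrow> (real \<Rightarrow> complex) set" where
  "beppo_levi_splines k n r = {\<eta>. \<eta> \<in> extensional {0..}
     \<and> (\<forall>j\<in>{1..<n}. times_differentiable_on 4 \<eta> {r j<..<r (j + 1)}
                    \<and> (\<forall>x\<in>{r j<..<r (j + 1)}. L_op k \<eta> x = 0))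
     \<and> times_differentiable_on 2 \<eta> {0<..<r 1} \<and> (\<forall>x\<in>{0<..<r 1}. G_op k \<eta> x = 0)
     \<and> times_differentiable_on 2 \<eta> {r n<..} \<and> (\<forall>x\<in>{r n<..}. R_op k \<eta> x = 0)
     \<and> (\<forall>j\<in>{1..n}. C2_at \<eta> (r j))
     \<and> (\<eta> \<longlongrightarrow> \<eta> 0) (at_right 0) \<and> \<eta> 0 = 0}"

end

theory Submission
  imports Defs
begin

text \<open>
  Put \<open>\<kappa> = \<bar>k\<bar>\<close> and \<open>\<theta> = r d/dr\<close>. Then \<open>r\<^sup>3 L\<^sub>k = (\<theta> - \<kappa>)(\<theta> + \<kappa>)(\<theta> - \<kappa> - 2)(\<theta> + \<kappa> - 2)\<close>, so on each
  interval between knots a spline is a combination of four explicit functions, and splines with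
  prescribed values at the knots are the solutions of a square linear system for the coefficients.
  It therefore suffices that a spline \<open>\<eta>\<close> vanishing at all knots is zero. With
  \<open>u = \<eta>'' + \<eta>'/r - \<kappa>\<^sup>2 \<eta>/r\<^sup>2\<close>, the flux \<open>F = u \<theta>\<eta> - \<eta> \<theta>u\<close> satisfies \<open>F' = r u\<^sup>2 \<ge> 0\<close> between knots; at a
  knot \<open>\<eta> = 0\<close>, so there \<open>F = u \<theta>\<eta>\<close>, which is continuous since \<open>\<eta>\<close> is \<open>C\<^sup>2\<close>. The explicit outer pieces
  give \<open>F(r\<^sub>1) \<ge> 0\<close> and \<open>F(r\<^sub>n) \<le> 0\<close>. Hence \<open>u = 0\<close> on \<open>[r\<^sub>1, r\<^sub>n]\<close>, where every piece is
  \<open>a r\<^bsup>\<kappa>\<^esup> + b r\<^bsup>-\<kappa>\<^esup>\<close> with two zeros and thus vanishes; so do the outer pieces by matching.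
\<close>

section \<open>Iterated derivatives read off from explicit chains\<close>

lemma nth_vderiv_Suc: "nth_vderiv (Suc i) f x = vector_derivative (nth_vderiv i f) (at x)"
  by (simp add: nth_vderiv_def)

lemma times_differentiable_onD:
  assumes "times_differentiable_on m f S" "i < m" "x \<in> S"
  shows "(nth_vderiv i f has_vector_derivative nth_vderiv (Suc i) f x) (at x)"
  using assms vector_derivative_works[of "nth_vderiv i f" "at x"]
  by (auto simp: times_differentiable_on_def nth_vderiv_Suc)

text \<open>A derivative depends only on a neighbourhood of the point, so agreement on the open set
  \<open>S\<close> passes from order \<open>i\<close> to order \<open>Suc i\<close>. All derivatives
  of a spline piece are computed this way, from an explicit chain of functions
  \<open>g\<close>.\<close>

lemma nth_vderiv_chain:
  assumes S: "open S" and f: "\<And>x. x \<in> S \<Longrightarrow> f x = g 0 x"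
    and g: "\<And>i x. i < m \<Longrightarrow> x \<in> S \<Longrightarrow> (g i has_vector_derivative g (Suc i) x) (at x)"
  shows "i \<le> m \<Longrightarrow> x \<in> S \<Longrightarrow> nth_vderiv i f x = g i x"
proof (induction i arbitrary: x)
  case 0
  then show ?case using f by (simp add: nth_vderiv_def)
next
  case (Suc i)
  have "(nth_vderiv i f has_vector_derivative g (Suc i) x) (at x)"
    using has_vector_derivative_transform_within_open[OF g[of i x] S] Suc by fastforce
  then show ?case
    by (simp add: nth_vderiv_Suc vector_derivative_at)
qed

lemma times_differentiable_on_chain:
  assumes S: "open S" and f: "\<And>x. x \<in> S \<Longrightarrow> f x = g 0 x"
    and g: "\<And>i x. i < m \<Longrightarrow> x \<in> S \<Longrightarrow> (g i has_vector_derivative g (Suc i) x) (at x)"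
  shows "times_differentiable_on m f S"
  unfolding times_differentiable_on_def
proof (intro allI impI ballI)
  fix i x assume ix: "i < m" "x \<in> S"
  have "(nth_vderiv i f has_vector_derivative g (Suc i) x) (at x)"
    using has_vector_derivative_transform_within_open[OF g[OF ix] S ix(2)]
      nth_vderiv_chain[where g = g, OF S f g] ix(1) by (metis less_imp_le)
  then show "nth_vderiv i f differentiable at x"
    by (rule differentiableI_vector)
qed

section \<open>The basis functions and the operators acting on them\<close>

text \<open>
  One would expect \<open>r\<^bsup>2-\<kappa>\<^esup>\<close> as the fourth basis element, but it coincides with
  \<open>r\<^bsup>\<kappa>\<^esup>\<close> for \<open>\<kappa> = 1\<close>. The divided difference below tends to \<open>r ln r\<close> as \<open>\<kappa> \<rightarrow> 1\<close>, so that all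
  later identities hold for every \<open>\<kappa> \<ge> 1\<close>.
\<close>

definition eb :: "real \<Rightarrow> nat \<Rightarrow> real \<Rightarrow> real" where
  "eb \<kappa> i x =
     (if i = 0 then x powr \<kappa>
      else if i = 1 then x powr (\<kappa> + 2)
      else if i = 2 then x powr - \<kappa>
      else if \<kappa> = 1 then x * ln x
      else (x powr (2 - \<kappa>) - x powr \<kappa>) / (2 - 2 * \<kappa>))"

definition ecomb :: "real \<Rightarrow> (nat \<Rightarrow> 'a::real_normed_field) \<Rightarrow> real \<Rightarrow> 'a" where
  "ecomb \<kappa> c x = (\<Sum>i<4. c i * of_real (eb \<kappa> i x))"

text \<open>The matrix of \<open>r d/dr\<close> in the basis \<open>eb\<close>. It is diagonal up to
  the extra \<open>c 3\<close> in entry 0, which stems from the divided difference: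
  \<open>r d/dr\<close> maps \<open>eb \<kappa> 3\<close> to
  \<open>(2 - \<kappa>) * eb \<kappa> 3 + eb \<kappa> 0\<close>.\<close>

definition theta :: "real \<Rightarrow> (nat \<Rightarrow> 'a::real_normed_field) \<Rightarrow> nat \<Rightarrow> 'a" where
  "theta \<kappa> c i =
     (if i = 0 then of_real \<kappa> * c 0 + c 3
      else if i = 1 then of_real (\<kappa> + 2) * c 1
      else if i = 2 then - of_real \<kappa> * c 2
      else of_real (2 - \<kappa>) * c 3)"

lemma sum_lessThan_4: "(\<Sum>i<4. f i) = f 0 + f 1 + f 2 + f 3" for f :: "nat \<Rightarrow> 'a::comm_monoid_add"
  by (simp add: numeral_eq_Suc lessThan_Suc ac_simps)

lemma powr_two_minus_eq_eb:
  assumes "0 < x"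
  shows "x powr (2 - \<kappa>) = eb \<kappa> 0 x + (2 - 2 * \<kappa>) * eb \<kappa> 3 x"
  by (simp add: eb_def)

lemma powr_has_real_derivative:
  fixes x m :: real
  assumes "0 < x"
  shows "((\<lambda>x. x powr m) has_real_derivative m * x powr m / x) (at x)"
  using assms by (auto intro!: derivative_eq_intros simp: powr_diff)

text \<open>For \<kappa> different from 1, replacing \<open>x powr (2 - \<kappa>)\<close> by its
  expression in \<open>eb\<close> leaves the remainder
  \<open>((2 - \<kappa>) - \<kappa>) / (2 - 2 * \<kappa>) = 1\<close> times
  \<open>x powr \<kappa>\<close>; for \<kappa> = 1 the same term comes from differentiating the
  logarithm.\<close>

lemma eb3_has_real_derivative:
  assumes x: "0 < x"
  shows "(eb \<kappa> 3 has_real_derivative ((2 - \<kappa>) * eb \<kappa> 3 x + eb \<kappa> 0 x) / x) (at x)"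
proof (cases "\<kappa> = 1")
  case True
  then have "eb \<kappa> 3 = (\<lambda>x. x * ln x)" "eb \<kappa> 0 x = x"
    using x by (auto simp: eb_def)
  then show ?thesis using True x
    by (auto intro!: derivative_eq_intros simp: add_divide_distrib)
next
  case False
  then have e: "eb \<kappa> 3 = (\<lambda>x. (x powr (2 - \<kappa>) - x powr \<kappa>) / (2 - 2 * \<kappa>))" "2 - 2 * \<kappa> \<noteq> 0"
    by (auto simp: eb_def)
  show ?thesis
    unfolding e(1)
    by (rule DERIV_cong[OF DERIV_cdivide[OF DERIV_diff[OF
            powr_has_real_derivative[OF x] powr_has_real_derivative[OF x]]]])
      (use e(2) x in \<open>simp add: eb_def field_simps\<close>)
qed

lemma ecomb_has_vector_derivative:
  fixes c :: "nat \<Rightarrow> 'a::real_normed_field"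
  assumes x: "0 < x"
  shows "(ecomb \<kappa> c has_vector_derivative ecomb \<kappa> (theta \<kappa> c) x / of_real x) (at x)"
proof -
  have d: "(eb \<kappa> 0 has_real_derivative \<kappa> * eb \<kappa> 0 x / x) (at x)"
    "(eb \<kappa> 1 has_real_derivative (\<kappa> + 2) * eb \<kappa> 1 x / x) (at x)"
    "(eb \<kappa> 2 has_real_derivative - \<kappa> * eb \<kappa> 2 x / x) (at x)"
    "(eb \<kappa> 3 has_real_derivative ((2 - \<kappa>) * eb \<kappa> 3 x + eb \<kappa> 0 x) / x) (at x)"
    using powr_has_real_derivative[OF x, of \<kappa>] powr_has_real_derivative[OF x, of "\<kappa> + 2"]
      powr_has_real_derivative[OF x, of "- \<kappa>"] eb3_has_real_derivative[OF x, of \<kappa>]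
    by (simp_all add: eb_def[abs_def])
  note d' = has_vector_derivative_of_real[OF d(1), where 'a = 'a]
    has_vector_derivative_of_real[OF d(2), where 'a = 'a]
    has_vector_derivative_of_real[OF d(3), where 'a = 'a]
    has_vector_derivative_of_real[OF d(4), where 'a = 'a]
  show ?thesis
    unfolding ecomb_def[abs_def] sum_lessThan_4
    by (rule has_vector_derivative_eq_rhs,
        (rule has_vector_derivative_add has_vector_derivative_mult_right d')+)
      (use x in \<open>simp add: theta_def field_simps\<close>)
qed

text \<open>\<open>delta \<kappa> c m\<close> are the coefficients of \<open>r\<^bsup>m\<^esup> d\<^bsup>m\<^esup>/dr\<^bsup>m\<^esup> (ecomb \<kappa> c)\<close>.\<close>

primrec delta :: "real \<Rightarrow> (nat \<Rightarrow> 'a::real_normed_field) \<Rightarrow> nat \<Rightarrow> nat \<Rightarrow> 'a" where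
  "delta \<kappa> c 0 = c"
| "delta \<kappa> c (Suc m) = (\<lambda>j. theta \<kappa> (delta \<kappa> c m) j - of_nat m * delta \<kappa> c m j)"

text \<open>With \<theta> = r d/dr one has
  \<open>r^(m+1) d^(m+1)/dr^(m+1) = (\<theta> - m) r^m d^m/dr^m\<close>: the subtracted multiple of
  \<open>m\<close> in \<open>delta\<close> is the derivative of the denominator.\<close>

lemma ecomb_chain:
  fixes c :: "nat \<Rightarrow> 'a::real_normed_field"
  assumes x: "0 < x"
  shows "((\<lambda>x. ecomb \<kappa> (delta \<kappa> c m) x / of_real x ^ m) has_vector_derivative
            ecomb \<kappa> (delta \<kappa> c (Suc m)) x / of_real x ^ Suc m) (at x)"
proof -
  have p: "((\<lambda>x. 1 / x ^ m) has_real_derivative - real m / x ^ Suc m) (at x)"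
    using x
    by (auto intro!: derivative_eq_intros simp: field_simps power_diff)
      (cases m; simp)
  have e: "ecomb \<kappa> (delta \<kappa> c (Suc m)) x =
      ecomb \<kappa> (theta \<kappa> (delta \<kappa> c m)) x - of_nat m * ecomb \<kappa> (delta \<kappa> c m) x"
    by (simp add: ecomb_def sum_lessThan_4 algebra_simps)
  have "((\<lambda>x. ecomb \<kappa> (delta \<kappa> c m) x * of_real (1 / x ^ m)) has_vector_derivative
            ecomb \<kappa> (delta \<kappa> c (Suc m)) x / of_real x ^ Suc m) (at x)"
    by (rule has_vector_derivative_eq_rhs,
        rule has_vector_derivative_mult[OF ecomb_has_vector_derivative[OF x]
          has_vector_derivative_of_real[OF p]])
      (use x in \<open>simp add: e field_simps del: delta.simps\<close>)
  then show ?thesis by simp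
qed

text \<open>Multiplication by \<open>x ^ 3\<close> clears all denominators and leaves an operator
  that acts on coefficients only. Each of the four basis functions is annihilated by a polynomial
  identity in \<kappa>.\<close>

lemma L_op_ecomb:
  assumes x: "0 < x"
    and f: "\<And>i. i \<le> 4 \<Longrightarrow>
      nth_vderiv i f x = ecomb \<bar>real_of_int k\<bar> (delta \<bar>real_of_int k\<bar> c i) x / of_real x ^ i"
  shows "L_op k f x = 0"
proof -
  define \<kappa> where "\<kappa> = \<bar>real_of_int k\<bar>"
  define E where "E i = ecomb \<kappa> (delta \<kappa> c i) x" for i
  have k: "real_of_int k ^ 2 = \<kappa> ^ 2" "real_of_int k ^ 4 = \<kappa> ^ 4" by (auto simp: \<kappa>_def)
  have n: "f x = E 0" "nth_vderiv 1 f x = E 1 / of_real x"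
    "nth_vderiv 2 f x = E 2 / of_real x ^ 2" "nth_vderiv 3 f x = E 3 / of_real x ^ 3"
    "nth_vderiv 4 f x = E 4 / of_real x ^ 4"
    using f[of 0] f[of 1] f[of 2] f[of 3] f[of 4]
    by (simp_all add: nth_vderiv_def[of 0] E_def \<kappa>_def)
  have "x ^ 3 *\<^sub>R L_op k f x = E 4 + 2 * E 3 - of_real (2 * \<kappa>\<^sup>2 + 1) * E 2
      + of_real (2 * \<kappa>\<^sup>2 + 1) * E 1 + of_real (\<kappa> ^ 4 - 4 * \<kappa>\<^sup>2) * E 0"
    unfolding L_op_def k using x
    by (simp add: n scaleR_conv_of_real divide_simps del: One_nat_def) algebra
  also have "\<dots> = 0"
    by (simp add: E_def ecomb_def sum_lessThan_4 numeral_eq_Suc theta_def) algebra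
  finally show ?thesis using x by simp
qed

lemma G_op_ecomb:
  assumes x: "0 < x" and c: "c 2 = 0" "c 3 = 0"
    and f: "\<And>i. i \<le> 2 \<Longrightarrow>
      nth_vderiv i f x = ecomb \<bar>real_of_int k\<bar> (delta \<bar>real_of_int k\<bar> c i) x / of_real x ^ i"
  shows "G_op k f x = 0"
proof -
  define \<kappa> where "\<kappa> = \<bar>real_of_int k\<bar>"
  define E where "E i = ecomb \<kappa> (delta \<kappa> c i) x" for i
  have n: "f x = E 0" "nth_vderiv 1 f x = E 1 / of_real x"
    "nth_vderiv 2 f x = E 2 / of_real x ^ 2"
    using f[of 0] f[of 1] f[of 2] by (simp_all add: nth_vderiv_def[of 0] E_def \<kappa>_def)
  have "x ^ 3 *\<^sub>R G_op k f x = E 2 - of_real (2 * \<kappa> + 1) * E 1 + of_real (\<kappa> * (\<kappa> + 2)) * E 0"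
    unfolding G_op_def \<kappa>_def[symmetric] using x
    by (simp add: n scaleR_conv_of_real divide_simps del: One_nat_def) algebra
  also have "\<dots> = 0"
    using c by (simp add: E_def ecomb_def sum_lessThan_4 numeral_eq_Suc theta_def algebra_simps)
  finally show ?thesis using x by simp
qed

text \<open>The relation between \<open>c 3\<close> and \<open>c 0\<close> merges these two terms
  into \<open>c 0\<close> times \<open>x powr (2 - \<kappa>)\<close>, by
  \<open>powr_two_minus_eq_eb\<close>. With \<open>x powr - \<kappa>\<close> this spans the null
  space of the outer operator.\<close>

lemma R_op_ecomb:
  assumes x: "0 < x" and c: "c 1 = 0" "c 3 = of_real (2 - 2 * \<bar>real_of_int k\<bar>) * c 0"
    and f: "\<And>i. i \<le> 2 \<Longrightarrow>
      nth_vderiv i f x = ecomb \<bar>real_of_int k\<bar> (delta \<bar>real_of_int k\<bar> c i) x / of_real x ^ i"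
  shows "R_op k f x = 0"
proof -
  define \<kappa> where "\<kappa> = \<bar>real_of_int k\<bar>"
  define E where "E i = ecomb \<kappa> (delta \<kappa> c i) x" for i
  have n: "f x = E 0" "nth_vderiv 1 f x = E 1 / of_real x"
    "nth_vderiv 2 f x = E 2 / of_real x ^ 2"
    using f[of 0] f[of 1] f[of 2] by (simp_all add: nth_vderiv_def[of 0] E_def \<kappa>_def)
  have c': "c (Suc 0) = 0" "c (Suc (Suc (Suc 0))) = of_real (2 - 2 * \<kappa>) * c 0"
    using c by (simp_all add: numeral_eq_Suc \<kappa>_def)
  have "x ^ 3 *\<^sub>R R_op k f x = E 2 + of_real (2 * \<kappa> - 1) * E 1 + of_real (\<kappa> * (\<kappa> - 2)) * E 0"
    unfolding R_op_def \<kappa>_def[symmetric] using x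
    by (simp add: n scaleR_conv_of_real divide_simps del: One_nat_def) algebra
  also have "\<dots> = 0"
    by (simp add: c' E_def ecomb_def sum_lessThan_4 numeral_eq_Suc theta_def algebra_simps)
  finally show ?thesis using x by simp
qed

section \<open>Euler equations and the null spaces of the three operators\<close>

lemma euler_first_order:
  fixes v :: "real \<Rightarrow> 'a::real_normed_field"
  assumes S: "convex S" "S \<subseteq> {0<..}"
    and v: "\<And>x. x \<in> S \<Longrightarrow> (v has_vector_derivative of_real m * v x / of_real x) (at x)"
  obtains C where "\<And>x. x \<in> S \<Longrightarrow> v x = C * of_real (x powr m)"
proof -
  \<comment> \<open>\<open>x powr - m\<close> is an integrating factor; convexity of
    \<open>S\<close> then makes the product constant.\<close>
  have d: "((\<lambda>x. v x * of_real (x powr - m)) has_derivative (\<lambda>h. 0)) (at x within S)" if "x \<in> S" for x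
  proof -
    have x: "0 < x" using S that by auto
    note p = powr_has_real_derivative[OF x, of "- m"]
    have "((\<lambda>x. v x * of_real (x powr - m)) has_vector_derivative 0) (at x)"
      by (rule has_vector_derivative_eq_rhs,
          rule has_vector_derivative_mult[OF v[OF that] has_vector_derivative_of_real[OF p]])
        (use x in \<open>simp add: field_simps\<close>)
    then show ?thesis
      by (auto simp: has_vector_derivative_def intro: has_derivative_at_withinI)
  qed
  obtain C where C: "\<And>x. x \<in> S \<Longrightarrow> v x * of_real (x powr - m) = C"
    using has_derivative_zero_constant[OF S(1) d] by auto
  show ?thesis
  proof (rule that)
    fix x assume "x \<in> S"
    then have "0 < x" using S by auto
    then have p: "x powr m * x powr - m = 1" by (simp add: powr_minus)
    have "v x = v x * of_real (x powr m * x powr - m)" unfolding p by simp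
    also have "\<dots> = C * of_real (x powr m)" using C[OF \<open>x \<in> S\<close>] by (simp add: mult_ac)
    finally show "v x = C * of_real (x powr m)" .
  qed
qed

text \<open>\<open>t i\<close> stands for \<theta>^i applied to \<open>t 0\<close>, so the equation
  reads (\<theta> - a)(\<theta> - b) \<open>t 0\<close> = 0. Either factor may be taken as the outer
  one, which gives two first-order equations; subtracting their solutions eliminates
  \<open>t 1\<close> and leaves \<open>(a - b) * t 0\<close>.\<close>

lemma euler_distinct_roots:
  fixes t :: "nat \<Rightarrow> real \<Rightarrow> 'a::real_normed_field"
  assumes S: "convex S" "S \<subseteq> {0<..}"
    and t: "\<And>i x. i < 2 \<Longrightarrow> x \<in> S \<Longrightarrow> (t i has_vector_derivative t (Suc i) x / of_real x) (at x)"
    and eq: "\<And>x. x \<in> S \<Longrightarrow> t 2 x - of_real (a + b) * t 1 x + of_real (a * b) * t 0 x = 0"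
    and ab: "a \<noteq> b"
  obtains A B where "\<And>x. x \<in> S \<Longrightarrow> t 0 x = A * of_real (x powr a) + B * of_real (x powr b)"
proof -
  have t': "(t 0 has_vector_derivative t 1 x / of_real x) (at x)"
    "(t 1 has_vector_derivative t 2 x / of_real x) (at x)" if "x \<in> S" for x
    using t[of 0 x] t[of 1 x] that by (auto simp: eval_nat_numeral)
  have fo: "\<exists>C. \<forall>x\<in>S. t 1 x - of_real b' * t 0 x = C * of_real (x powr a')"
    if s: "a' + b' = a + b" "a' * b' = a * b" for a' b'
  proof (rule euler_first_order[OF S, of "\<lambda>x. t 1 x - of_real b' * t 0 x" a'])
    fix x assume x: "x \<in> S"
    have x0: "of_real x \<noteq> (0::'a)" using x S by auto
    have e: "t 2 x - of_real b' * t 1 x = of_real a' * (t 1 x - of_real b' * t 0 x)"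
      using eq[OF x] unfolding s[symmetric] by (simp add: algebra_simps)
    show "((\<lambda>x. t 1 x - of_real b' * t 0 x) has_vector_derivative
        of_real a' * (t 1 x - of_real b' * t 0 x) / of_real x) (at x)"
      unfolding e[symmetric]
      by (rule has_vector_derivative_eq_rhs, (rule has_vector_derivative_diff
            has_vector_derivative_mult_right t'[OF x])+) (use x0 in \<open>simp add: field_simps\<close>)
  qed blast
  obtain A B where AB: "\<And>x. x \<in> S \<Longrightarrow> t 1 x - of_real b * t 0 x = A * of_real (x powr a)"
    "\<And>x. x \<in> S \<Longrightarrow> t 1 x - of_real a * t 0 x = B * of_real (x powr b)"
    using fo[of a b] fo[of b a] by (auto simp: mult_ac add_ac)
  have "of_real (a - b) \<noteq> (0::'a)" using ab by simp
  moreover have "of_real (a - b) * t 0 x = A * of_real (x powr a) - B * of_real (x powr b)"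
    if "x \<in> S" for x using AB[OF that] by (simp add: algebra_simps)
  ultimately have "t 0 x = (A * of_real (x powr a) - B * of_real (x powr b)) / of_real (a - b)"
    if "x \<in> S" for x using that by (metis nonzero_mult_div_cancel_left)
  then have "t 0 x = (A / of_real (a - b)) * of_real (x powr a)
      + (- B / of_real (a - b)) * of_real (x powr b)" if "x \<in> S" for x
    using that by (simp add: diff_divide_distrib del: of_real_diff)
  then show ?thesis by (rule that)
qed

text \<open>The characteristic roots are \<kappa> + 2, -\<kappa>, \<kappa> and 2 - \<kappa>. The
  first two are split off separately; the last two coincide for \<kappa> = 1 and are treated
  together, with \<open>eb \<kappa> 3\<close> as a particular solution.\<close>

lemma euler_fourth_order:
  fixes t :: "nat \<Rightarrow> real \<Rightarrow> 'a::real_normed_field"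
  assumes S: "convex S" "S \<subseteq> {0<..}" and \<kappa>: "1 \<le> \<kappa>"
    and t: "\<And>i x. i < 4 \<Longrightarrow> x \<in> S \<Longrightarrow> (t i has_vector_derivative t (Suc i) x / of_real x) (at x)"
    and eq: "\<And>x. x \<in> S \<Longrightarrow> t 4 x - 4 * t 3 x + of_real (4 - 2 * \<kappa>\<^sup>2) * t 2 x
      + of_real (4 * \<kappa>\<^sup>2) * t 1 x + of_real (\<kappa> ^ 4 - 4 * \<kappa>\<^sup>2) * t 0 x = 0"
  obtains c where "\<And>x. x \<in> S \<Longrightarrow> t 0 x = ecomb \<kappa> c x"
proof -
  have t': "(t 0 has_vector_derivative t 1 x / of_real x) (at x)"
    "(t 1 has_vector_derivative t 2 x / of_real x) (at x)"
    "(t 2 has_vector_derivative t 3 x / of_real x) (at x)"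
    "(t 3 has_vector_derivative t 4 x / of_real x) (at x)" if "x \<in> S" for x
    using t[of 0 x] t[of 1 x] t[of 2 x] t[of 3 x] that by (auto simp: eval_nat_numeral)
  have x0: "of_real x \<noteq> (0::'a)" if "x \<in> S" for x using that S by auto
  \<comment> \<open>The four side conditions compare coefficients in
    \<open>(\<theta> - m) (\<theta>^3 + a \<theta>^2 + b \<theta> + d)\<close>. For each root
    \<open>m\<close> the cubic cofactor applied to \<open>t 0\<close> is then a multiple of
    \<open>x powr m\<close>.\<close>
  have fo: "\<exists>C. \<forall>x\<in>S. t 3 x + of_real a * t 2 x + of_real b * t 1 x + of_real d * t 0 x
      = C * of_real (x powr m)"
    if s: "a - m = - 4" "b - m * a = 4 - 2 * \<kappa>\<^sup>2" "d - m * b = 4 * \<kappa>\<^sup>2" "- m * d = \<kappa> ^ 4 - 4 * \<kappa>\<^sup>2"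
    for m a b d
  proof (rule euler_first_order[OF S, of _ m])
    fix x assume x: "x \<in> S"
    have e: "t 4 x + of_real a * t 3 x + of_real b * t 2 x + of_real d * t 1 x
        = of_real m * (t 3 x + of_real a * t 2 x + of_real b * t 1 x + of_real d * t 0 x)"
    proof -
      have "m - a = 4" using s(1) by simp
      then have s4: "of_real (m - a) = (4::'a)" by simp
      have "t 4 x - of_real (m - a) * t 3 x + of_real (b - m * a) * t 2 x
          + of_real (d - m * b) * t 1 x + of_real (- m * d) * t 0 x = 0"
        using eq[OF x] by (simp only: s s4)
      then show ?thesis by (simp add: algebra_simps)
    qed
    show "((\<lambda>x. t 3 x + of_real a * t 2 x + of_real b * t 1 x + of_real d * t 0 x)
       has_vector_derivative of_real m *
        (t 3 x + of_real a * t 2 x + of_real b * t 1 x + of_real d * t 0 x) / of_real x) (at x)"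
      unfolding e[symmetric]
      by (rule has_vector_derivative_eq_rhs, (rule has_vector_derivative_add
            has_vector_derivative_mult_right t'[OF x])+) (use x0[OF x] in \<open>simp add: field_simps\<close>)
  qed blast
  obtain A where A: "\<And>x. x \<in> S \<Longrightarrow> t 3 x + of_real (\<kappa> - 2) * t 2 x + of_real (- \<kappa>\<^sup>2) * t 1 x
      + of_real (- \<kappa>\<^sup>2 * (\<kappa> - 2)) * t 0 x = A * of_real (x powr (\<kappa> + 2))"
    using fo[of "\<kappa> - 2" "\<kappa> + 2" "- \<kappa>\<^sup>2" "- \<kappa>\<^sup>2 * (\<kappa> - 2)"]
    by (auto simp: algebra_simps power2_eq_square power4_eq_xxxx)
  obtain B where B: "\<And>x. x \<in> S \<Longrightarrow> t 3 x + of_real (- \<kappa> - 4) * t 2 x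
      + of_real (- \<kappa>\<^sup>2 + 4 * \<kappa> + 4) * t 1 x
      + of_real (\<kappa>\<^sup>2 * \<kappa> - 4 * \<kappa>) * t 0 x = B * of_real (x powr - \<kappa>)"
    using fo[of "- \<kappa> - 4" "- \<kappa>" "- \<kappa>\<^sup>2 + 4 * \<kappa> + 4" "\<kappa>\<^sup>2 * \<kappa> - 4 * \<kappa>"]
    by (auto simp: algebra_simps power2_eq_square power4_eq_xxxx)
  \<comment> \<open>\<open>p\<close> is (\<theta> + \<kappa>)(\<theta> - \<kappa> - 2) applied to
    \<open>t 0\<close>, so only the roots \<kappa> and 2 - \<kappa> remain; \<open>p'\<close> is
    \<theta> applied to \<open>p\<close>.\<close>
  define p where "p x = t 2 x - 2 * t 1 x - of_real (\<kappa> * (\<kappa> + 2)) * t 0 x" for x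
  define p' where "p' x = t 3 x - 2 * t 2 x - of_real (\<kappa> * (\<kappa> + 2)) * t 1 x" for x
  have dp: "(p has_vector_derivative p' x / of_real x) (at x)" if x: "x \<in> S" for x
    unfolding p_def[abs_def] p'_def
    by (rule has_vector_derivative_eq_rhs, (rule has_vector_derivative_diff
            has_vector_derivative_mult_right t'[OF x])+) (use x0[OF x] in \<open>simp add: field_simps\<close>)
  obtain C where C: "\<And>x. x \<in> S \<Longrightarrow> p' x - of_real (2 - \<kappa>) * p x = C * of_real (x powr \<kappa>)"
  proof -
    have "\<exists>C. \<forall>x\<in>S. t 3 x + of_real (\<kappa> - 4) * t 2 x + of_real (4 - 4 * \<kappa> - \<kappa>\<^sup>2) * t 1 x
      + of_real ((2 - \<kappa>) * \<kappa> * (\<kappa> + 2)) * t 0 x = C * of_real (x powr \<kappa>)"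
      by (rule fo) (simp_all add: algebra_simps power2_eq_square power4_eq_xxxx)
    then obtain C where C: "\<And>x. x \<in> S \<Longrightarrow> t 3 x + of_real (\<kappa> - 4) * t 2 x
      + of_real (4 - 4 * \<kappa> - \<kappa>\<^sup>2) * t 1 x
      + of_real ((2 - \<kappa>) * \<kappa> * (\<kappa> + 2)) * t 0 x = C * of_real (x powr \<kappa>)" by blast
    show ?thesis
      by (rule that[of C], subst C[symmetric], assumption)
        (simp add: p_def p'_def algebra_simps power2_eq_square)
  qed
  \<comment> \<open>(\<theta> - (2 - \<kappa>)) maps \<open>eb \<kappa> 3\<close> to
    \<open>eb \<kappa> 0\<close>, so \<open>C\<close> times \<open>eb \<kappa> 3\<close> is a
    particular solution of the equation for \<open>p\<close>.\<close>
  obtain D where D: "\<And>x. x \<in> S \<Longrightarrow> p x - C * of_real (eb \<kappa> 3 x) = D * of_real (x powr (2 - \<kappa>))"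
  proof (rule euler_first_order[OF S, of "\<lambda>x. p x - C * of_real (eb \<kappa> 3 x)" "2 - \<kappa>"])
    fix x assume x: "x \<in> S"
    then have "0 < x" using S by auto
    note d3 = has_vector_derivative_of_real[OF eb3_has_real_derivative[OF this], where 'a = 'a, of \<kappa>]
    have e: "p' x = of_real (2 - \<kappa>) * p x + C * of_real (eb \<kappa> 0 x)"
      using C[OF x] by (simp add: eb_def algebra_simps)
    show "((\<lambda>x. p x - C * of_real (eb \<kappa> 3 x)) has_vector_derivative
        of_real (2 - \<kappa>) * (p x - C * of_real (eb \<kappa> 3 x)) / of_real x) (at x)"
      by (rule has_vector_derivative_eq_rhs, rule has_vector_derivative_diff[OF dp[OF x]
            has_vector_derivative_mult_right[OF d3]])
        (use x0[OF x] in \<open>simp add: e field_simps\<close>)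
  qed blast
  \<comment> \<open>Subtracting the cubics of \<open>B\<close> from those of \<open>A\<close> leaves
    2(\<kappa> + 1) times a quadratic in \<theta> that differs from the one defining
    \<open>p\<close> by the constant 4\<kappa>. Hence the factor 8\<kappa>(\<kappa> + 1) in front of
    \<open>t 0\<close>.\<close>
  define N where "N = (of_real (8 * \<kappa> * (\<kappa> + 1)) :: 'a)"
  have "8 * \<kappa> * (\<kappa> + 1) \<noteq> 0" using \<kappa> by auto
  then have N: "N \<noteq> 0" unfolding N_def by (metis of_real_eq_0_iff)
  define c where "c i = (if i = 0 then - of_real (2 * (\<kappa> + 1)) * D
     else if i = 1 then A else if i = 2 then - B
     else - of_real (2 * (\<kappa> + 1)) * (C + of_real (2 - 2 * \<kappa>) * D)) / N" for i :: nat
  have c: "c 0 * N = - of_real (2 * (\<kappa> + 1)) * D" "c 1 * N = A" "c 2 * N = - B"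
    "c 3 * N = - of_real (2 * (\<kappa> + 1)) * (C + of_real (2 - 2 * \<kappa>) * D)"
    using N by (simp_all add: c_def)
  show ?thesis
  proof (rule that)
    fix x assume x: "x \<in> S"
    then have xp: "0 < x" using S by auto
    have "N * t 0 x = - of_real (2 * (\<kappa> + 1)) * p x
      + A * of_real (x powr (\<kappa> + 2)) - B * of_real (x powr - \<kappa>)"
      unfolding A[OF x, symmetric] B[OF x, symmetric] N_def p_def
      by (simp add: algebra_simps power2_eq_square)
    also have "p x = C * of_real (eb \<kappa> 3 x) + D * of_real (eb \<kappa> 0 x + (2 - 2 * \<kappa>) * eb \<kappa> 3 x)"
      using D[OF x] powr_two_minus_eq_eb[OF xp] by (metis diff_eq_eq add.commute)
    also have "x powr (\<kappa> + 2) = eb \<kappa> 1 x" by (simp add: eb_def)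
    also have "x powr - \<kappa> = eb \<kappa> 2 x" by (simp add: eb_def)
    also have "- of_real (2 * (\<kappa> + 1)) * (C * of_real (eb \<kappa> 3 x)
        + D * of_real (eb \<kappa> 0 x + (2 - 2 * \<kappa>) * eb \<kappa> 3 x))
        + A * of_real (eb \<kappa> 1 x) - B * of_real (eb \<kappa> 2 x) = N * ecomb \<kappa> c x"
    proof -
      have "N * ecomb \<kappa> c x = c 0 * N * of_real (eb \<kappa> 0 x) + c 1 * N * of_real (eb \<kappa> 1 x)
          + c 2 * N * of_real (eb \<kappa> 2 x) + c 3 * N * of_real (eb \<kappa> 3 x)"
        unfolding ecomb_def sum_lessThan_4 by (simp add: algebra_simps)
      then show ?thesis unfolding c by (simp add: algebra_simps)
    qed
    finally show "t 0 x = ecomb \<kappa> c x" using N by simp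
  qed
qed

lemma L_op_zero_imp_ecomb:
  assumes S: "convex S" "S \<subseteq> {0<..}" and k: "k \<noteq> 0"
    and f: "times_differentiable_on 4 f S" "\<And>x. x \<in> S \<Longrightarrow> L_op k f x = 0"
  obtains c where "\<And>x. x \<in> S \<Longrightarrow> f x = ecomb \<bar>real_of_int k\<bar> c x"
proof -
  define \<kappa> where "\<kappa> = \<bar>real_of_int k\<bar>"
  have k2: "real_of_int k ^ 2 = \<kappa> ^ 2" "real_of_int k ^ 4 = \<kappa> ^ 4" by (auto simp: \<kappa>_def)
  have \<kappa>: "1 \<le> \<kappa>" using k unfolding \<kappa>_def by linarith
  define F where "F i = nth_vderiv i f" for i
  \<comment> \<open>\<open>t i\<close> is \<theta>^i applied to \<open>f\<close>, expanded in the
    terms \<open>x^m F m\<close>. The coefficients 1, 3, 1 and 1, 7, 6, 1 are Stirling numbers of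
    the second kind.\<close>
  define t where "t i x = (if i = 0 then F 0 x else if i = 1 then of_real x ^ 1 * F 1 x
    else if i = 2 then of_real x ^ 1 * F 1 x + of_real x ^ 2 * F 2 x
    else if i = 3 then of_real x ^ 1 * F 1 x + 3 * (of_real x ^ 2 * F 2 x) + of_real x ^ 3 * F 3 x
    else of_real x ^ 1 * F 1 x + 7 * (of_real x ^ 2 * F 2 x) + 6 * (of_real x ^ 3 * F 3 x)
      + of_real x ^ 4 * F 4 x)" for i :: nat and x
  have dF: "(F i has_vector_derivative F (Suc i) x) (at x)" if "i < 4" "x \<in> S" for i x
    using times_differentiable_onD[OF f(1) that] by (simp add: F_def)
  have dx: "((\<lambda>x. complex_of_real x ^ m) has_vector_derivative of_nat m * of_real x ^ (m - 1)) (at x)"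
    for m and x :: real
    using has_vector_derivative_of_real[OF DERIV_pow[of m x], where 'a = complex] by simp
  have dxF: "((\<lambda>x. of_real x ^ m * F i x) has_vector_derivative
      of_real x ^ m * F (Suc i) x + of_nat m * of_real x ^ (m - 1) * F i x) (at x)"
    if "i < 4" "x \<in> S" for m i x
    by (rule has_vector_derivative_mult[OF dx dF[OF that]])
  show ?thesis
  proof (rule euler_fourth_order[OF S \<kappa>, of t])
    fix i x assume i: "i < (4::nat)" and x: "x \<in> S"
    have x0: "complex_of_real x \<noteq> 0" using x S by auto
    have lt: "1 < (4::nat)" "2 < (4::nat)" "3 < (4::nat)" by simp_all
    consider "i = 0" | "i = 1" | "i = 2" | "i = 3" using i by linarith
    then show "(t i has_vector_derivative t (Suc i) x / of_real x) (at x)"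
    proof cases
      case 1
      show ?thesis using dF[of 0 x] x x0 unfolding 1 by (simp add: t_def[abs_def])
    next
      case 2
      show ?thesis unfolding 2 t_def[abs_def]
        by (simp del: power_one_right One_nat_def, rule has_vector_derivative_eq_rhs,
            (rule has_vector_derivative_add has_vector_derivative_mult_right dxF[OF lt(1) x]
              dxF[OF lt(2) x] dxF[OF lt(3) x])+)
          (use x0 in \<open>simp_all add: field_simps eval_nat_numeral\<close>)
    next
      case 3
      show ?thesis unfolding 3 t_def[abs_def]
        by (simp del: power_one_right One_nat_def, rule has_vector_derivative_eq_rhs,
            (rule has_vector_derivative_add has_vector_derivative_mult_right dxF[OF lt(1) x]
              dxF[OF lt(2) x] dxF[OF lt(3) x])+)
          (use x0 in \<open>simp_all add: field_simps eval_nat_numeral\<close>)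
    next
      case 4
      show ?thesis unfolding 4 t_def[abs_def]
        by (simp del: power_one_right One_nat_def, rule has_vector_derivative_eq_rhs,
            (rule has_vector_derivative_add has_vector_derivative_mult_right dxF[OF lt(1) x]
              dxF[OF lt(2) x] dxF[OF lt(3) x])+)
          (use x0 in \<open>simp_all add: field_simps eval_nat_numeral\<close>)
    qed
  next
    fix x assume x: "x \<in> S"
    then have x0: "0 < x" using S by auto
    have f0: "f x = F 0 x" by (simp add: F_def nth_vderiv_def)
    have e: "of_real x ^ 3 * L_op k f x = of_real x ^ 4 * F 4 x + 2 * of_real x ^ 3 * F 3 x
      - (2 * of_real \<kappa> ^ 2 + 1) * of_real x ^ 2 * F 2 x
      + (2 * of_real \<kappa> ^ 2 + 1) * of_real x * F 1 x
      + (of_real \<kappa> ^ 4 - 4 * of_real \<kappa> ^ 2) * F 0 x"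
      unfolding L_op_def k2 F_def[symmetric] f0 using x0
      by (simp add: scaleR_conv_of_real divide_simps del: One_nat_def) algebra
    show "t 4 x - 4 * t 3 x + of_real (4 - 2 * \<kappa>\<^sup>2) * t 2 x
      + of_real (4 * \<kappa>\<^sup>2) * t 1 x + of_real (\<kappa> ^ 4 - 4 * \<kappa>\<^sup>2) * t 0 x = 0"
      using e unfolding f(2)[OF x] by (simp add: t_def algebra_simps)
  next
    fix c assume "\<And>x. x \<in> S \<Longrightarrow> t 0 x = ecomb \<kappa> c x"
    then show ?thesis
      using that[of c] by (simp add: t_def F_def nth_vderiv_def \<kappa>_def)
  qed
qed

text \<open>After multiplication by \<open>x ^ 3\<close> this is an Euler equation with roots
  \<kappa> + 2 and \<kappa>, which always differ by 2.\<close>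

lemma G_op_zero_imp_ecomb:
  assumes S: "convex S" "S \<subseteq> {0<..}"
    and f: "times_differentiable_on 2 f S" "\<And>x. x \<in> S \<Longrightarrow> G_op k f x = 0"
  obtains c where "\<And>x. x \<in> S \<Longrightarrow> f x = ecomb \<bar>real_of_int k\<bar> c x" "c 2 = 0" "c 3 = 0"
proof -
  define \<kappa> where "\<kappa> = \<bar>real_of_int k\<bar>"
  define F where "F i = nth_vderiv i f" for i
  define t where "t i x = (if i = 0 then F 0 x else if i = 1 then of_real x * F 1 x
    else of_real x * F 1 x + of_real x ^ 2 * F 2 x)" for i :: nat and x
  have dF: "(F i has_vector_derivative F (Suc i) x) (at x)" if "i < 2" "x \<in> S" for i x
    using times_differentiable_onD[OF f(1) that] by (simp add: F_def)
  have dx: "(complex_of_real has_vector_derivative 1) (at x)" for x :: real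
    using has_vector_derivative_of_real[OF DERIV_ident, of "at x", where 'a = complex] by simp
  obtain A B where AB: "\<And>x. x \<in> S \<Longrightarrow> t 0 x = A * of_real (x powr (\<kappa> + 2)) + B * of_real (x powr \<kappa>)"
  proof (rule euler_distinct_roots[OF S, of t "\<kappa> + 2" \<kappa>])
    fix i x assume i: "i < (2::nat)" and x: "x \<in> S"
    have x0: "complex_of_real x \<noteq> 0" using x S by auto
    have lt: "1 < (2::nat)" by simp
    consider "i = 0" | "i = 1" using i by linarith
    then show "(t i has_vector_derivative t (Suc i) x / of_real x) (at x)"
    proof cases
      case 1
      show ?thesis using dF[of 0 x] x x0 unfolding 1 by (simp add: t_def[abs_def])
    next
      case 2
      show ?thesis unfolding 2 t_def[abs_def]
        by (simp del: One_nat_def, rule has_vector_derivative_eq_rhs,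
            (rule has_vector_derivative_mult dx dF[OF lt x])+)
          (use x0 in \<open>simp_all add: field_simps eval_nat_numeral\<close>)
    qed
  next
    fix x assume x: "x \<in> S"
    then have x0: "0 < x" using S by auto
    have f0: "f x = F 0 x" by (simp add: F_def nth_vderiv_def)
    have e: "of_real x ^ 3 * G_op k f x = of_real x ^ 2 * F 2 x
      - (2 * of_real \<kappa> + 1) * (of_real x * F 1 x) + of_real \<kappa> * (of_real \<kappa> + 2) * F 0 x"
      unfolding G_op_def F_def[symmetric] f0 \<kappa>_def[symmetric] using x0
      by (simp add: scaleR_conv_of_real divide_simps del: One_nat_def) algebra
    show "t 2 x - of_real ((\<kappa> + 2) + \<kappa>) * t 1 x + of_real ((\<kappa> + 2) * \<kappa>) * t 0 x = 0"
      using e unfolding f(2)[OF x] by (simp add: t_def algebra_simps)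
  qed auto
  define c where "c i = (if i = 0 then B else if i = 1 then A else 0)" for i :: nat
  show ?thesis
  proof (rule that)
    fix x assume x: "x \<in> S"
    then have "0 < x" using S by auto
    then show "f x = ecomb \<bar>real_of_int k\<bar> c x"
      using AB[OF x] powr_two_minus_eq_eb[of x \<kappa>] unfolding \<kappa>_def[symmetric] ecomb_def sum_lessThan_4
      by (simp add: t_def F_def nth_vderiv_def c_def) (simp add: eb_def)
  qed (simp_all add: c_def \<kappa>_def)
qed

lemma R_op_zero_imp_ecomb:
  assumes S: "convex S" "S \<subseteq> {0<..}"
    and f: "times_differentiable_on 2 f S" "\<And>x. x \<in> S \<Longrightarrow> R_op k f x = 0"
  obtains c where "\<And>x. x \<in> S \<Longrightarrow> f x = ecomb \<bar>real_of_int k\<bar> c x" "c 1 = 0"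
    "c 3 = of_real (2 - 2 * \<bar>real_of_int k\<bar>) * c 0"
proof -
  define \<kappa> where "\<kappa> = \<bar>real_of_int k\<bar>"
  define F where "F i = nth_vderiv i f" for i
  define t where "t i x = (if i = 0 then F 0 x else if i = 1 then of_real x * F 1 x
    else of_real x * F 1 x + of_real x ^ 2 * F 2 x)" for i :: nat and x
  have dF: "(F i has_vector_derivative F (Suc i) x) (at x)" if "i < 2" "x \<in> S" for i x
    using times_differentiable_onD[OF f(1) that] by (simp add: F_def)
  have dx: "(complex_of_real has_vector_derivative 1) (at x)" for x :: real
    using has_vector_derivative_of_real[OF DERIV_ident, of "at x", where 'a = complex] by simp
  obtain A B where AB: "\<And>x. x \<in> S \<Longrightarrow> t 0 x = A * of_real (x powr (2 - \<kappa>)) + B * of_real (x powr (- \<kappa>))"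
  proof (rule euler_distinct_roots[OF S, of t "2 - \<kappa>" "- \<kappa>"])
    fix i x assume i: "i < (2::nat)" and x: "x \<in> S"
    have x0: "complex_of_real x \<noteq> 0" using x S by auto
    have lt: "1 < (2::nat)" by simp
    consider "i = 0" | "i = 1" using i by linarith
    then show "(t i has_vector_derivative t (Suc i) x / of_real x) (at x)"
    proof cases
      case 1
      show ?thesis using dF[of 0 x] x x0 unfolding 1 by (simp add: t_def[abs_def])
    next
      case 2
      show ?thesis unfolding 2 t_def[abs_def]
        by (simp del: One_nat_def, rule has_vector_derivative_eq_rhs,
            (rule has_vector_derivative_mult dx dF[OF lt x])+)
          (use x0 in \<open>simp_all add: field_simps eval_nat_numeral\<close>)
    qed
  next
    fix x assume x: "x \<in> S"
    then have x0: "0 < x" using S by auto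
    have f0: "f x = F 0 x" by (simp add: F_def nth_vderiv_def)
    have e: "of_real x ^ 3 * R_op k f x = of_real x ^ 2 * F 2 x
      + (2 * of_real \<kappa> - 1) * (of_real x * F 1 x) + of_real \<kappa> * (of_real \<kappa> - 2) * F 0 x"
      unfolding R_op_def F_def[symmetric] f0 \<kappa>_def[symmetric] using x0
      by (simp add: scaleR_conv_of_real divide_simps del: One_nat_def) algebra
    show "t 2 x - of_real ((2 - \<kappa>) + (- \<kappa>)) * t 1 x + of_real ((2 - \<kappa>) * (- \<kappa>)) * t 0 x = 0"
      using e unfolding f(2)[OF x] by (simp add: t_def algebra_simps)
  qed auto
  \<comment> \<open>The power \<open>x powr (2 - \<kappa>)\<close> is not itself in the basis, so
    its coefficient \<open>A\<close> enters at both index 0 and index 3.\<close>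
  define c where "c i = (if i = 0 then A else if i = 1 then 0 else if i = 2 then B else of_real (2 - 2 * \<kappa>) * A)" for i :: nat
  show ?thesis
  proof (rule that)
    fix x assume x: "x \<in> S"
    then have "0 < x" using S by auto
    then show "f x = ecomb \<bar>real_of_int k\<bar> c x"
      using AB[OF x] powr_two_minus_eq_eb[of x \<kappa>] unfolding \<kappa>_def[symmetric] ecomb_def sum_lessThan_4
      by (simp add: t_def F_def nth_vderiv_def c_def) (simp add: eb_def[of \<kappa> 2] algebra_simps)
  qed (simp_all add: c_def \<kappa>_def)
qed

section \<open>Uniqueness by monotonicity of the flux\<close>

text \<open>A zero at \<open>z\<close> means \<open>B = - A * z powr (2 * \<kappa>)\<close>, and
  this power is strictly increasing in \<open>z\<close>.\<close>

lemma powr_combination_two_zeros: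
  fixes A B :: real
  assumes "0 < \<kappa>" "0 < x" "x < y"
    and "A * x powr \<kappa> + B * x powr - \<kappa> = 0" "A * y powr \<kappa> + B * y powr - \<kappa> = 0"
  shows "A = 0" "B = 0"
proof -
  have B: "B = - A * z powr (2 * \<kappa>)"
    if "0 < z" "A * z powr \<kappa> + B * z powr - \<kappa> = 0" for z
  proof -
    have "z powr \<kappa> * (A * z powr \<kappa> + B * z powr - \<kappa>)
        = A * z powr (\<kappa> + \<kappa>) + B * z powr (\<kappa> + - \<kappa>)"
      by (simp only: powr_add) (simp add: algebra_simps)
    then show ?thesis using that by simp
  qed
  have "x powr (2 * \<kappa>) < y powr (2 * \<kappa>)" using assms by (intro powr_less_mono2) auto
  moreover have "A * x powr (2 * \<kappa>) = A * y powr (2 * \<kappa>)"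
    using B[of x] B[of y] assms by simp
  ultimately show "A = 0" by auto
  then show "B = 0" using B[of x] assms by simp
qed

text \<open>
  The coefficients of \<open>\<Delta>\<eta>\<close> for \<open>\<Delta> = d\<^sup>2/dr\<^sup>2 + (1/r) d/dr - \<kappa>\<^sup>2/r\<^sup>2\<close> and \<open>\<eta> = ecomb \<kappa> c\<close>.
\<close>

definition lap :: "real \<Rightarrow> (nat \<Rightarrow> real) \<Rightarrow> nat \<Rightarrow> real" where
  "lap \<kappa> c i = (if i = 0 then 4 * (\<kappa> + 1) * c 1 else if i = 2 then 2 * c 3 else 0)"

text \<open>The boundary term of Green's formula for the integral of r u^2 with u = \<Delta>\<eta>:
  a Wronskian of u and \<eta> with respect to r d/dr.\<close>

definition flux :: "real \<Rightarrow> (nat \<Rightarrow> real) \<Rightarrow> real \<Rightarrow> real" where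
  "flux \<kappa> c x = ecomb \<kappa> (lap \<kappa> c) x * ecomb \<kappa> (theta \<kappa> c) x
     - ecomb \<kappa> (theta \<kappa> (lap \<kappa> c)) x * ecomb \<kappa> c x"

text \<open>\<theta>^2 - \<kappa>^2 kills \<open>eb \<kappa> 0\<close> and
  \<open>eb \<kappa> 2\<close>, multiplies \<open>eb \<kappa> 1\<close> by 4(\<kappa> + 1), and maps
  \<open>eb \<kappa> 3\<close> to \<open>2 * x powr (2 - \<kappa>)\<close>. Dividing by x^2 gives
  the two nonzero entries of \<open>lap\<close>.\<close>

lemma ecomb_lap:
  assumes x: "0 < x"
  shows "x\<^sup>2 * ecomb \<kappa> (lap \<kappa> c) x = ecomb \<kappa> (theta \<kappa> (theta \<kappa> c)) x - \<kappa>\<^sup>2 * ecomb \<kappa> c x"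
proof -
  have p: "x powr (m + 2) = x\<^sup>2 * x powr m" for m
    using x by (simp add: powr_add)
  have e: "x\<^sup>2 * eb \<kappa> 0 x = eb \<kappa> 1 x" "x\<^sup>2 * eb \<kappa> 2 x = eb \<kappa> 0 x + (2 - 2 * \<kappa>) * eb \<kappa> 3 x"
    using p[of \<kappa>] p[of "- \<kappa>"] powr_two_minus_eq_eb[OF x, of \<kappa>]
    by (simp_all add: eb_def[of \<kappa> 0] eb_def[of \<kappa> 1] eb_def[of \<kappa> 2] add.commute del: One_nat_def)
  have "x\<^sup>2 * ecomb \<kappa> (lap \<kappa> c) x
      = 4 * (\<kappa> + 1) * c 1 * (x\<^sup>2 * eb \<kappa> 0 x) + 2 * c 3 * (x\<^sup>2 * eb \<kappa> 2 x)"
    by (simp add: ecomb_def sum_lessThan_4 lap_def algebra_simps)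
  then show ?thesis
    unfolding e by (simp add: ecomb_def sum_lessThan_4 theta_def algebra_simps power2_eq_square)
qed

text \<open>The mixed products of first derivatives cancel. Since u is a combination of the powers
  \<kappa> and -\<kappa>, \<theta>^2 u = \<kappa>^2 u; what is left is u times (\<theta>^2 -
  \<kappa>^2)\<eta> = x^2 u, divided by x.\<close>

lemma flux_has_real_derivative:
  assumes x: "0 < x"
  shows "(flux \<kappa> c has_real_derivative x * (ecomb \<kappa> (lap \<kappa> c) x)\<^sup>2) (at x)"
proof -
  have d: "(ecomb \<kappa> d has_real_derivative ecomb \<kappa> (theta \<kappa> d) x / x) (at x)" for d
    using ecomb_has_vector_derivative[OF x, of \<kappa> d]
    by (simp add: has_real_derivative_iff_has_vector_derivative)
  have l: "ecomb \<kappa> (theta \<kappa> (theta \<kappa> (lap \<kappa> c))) x = \<kappa>\<^sup>2 * ecomb \<kappa> (lap \<kappa> c) x"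
    by (simp add: ecomb_def sum_lessThan_4 theta_def lap_def power2_eq_square algebra_simps)
  have "x * (ecomb \<kappa> (lap \<kappa> c) x)\<^sup>2 = ecomb \<kappa> (lap \<kappa> c) x * (x\<^sup>2 * ecomb \<kappa> (lap \<kappa> c) x) / x"
    using x by (simp add: power2_eq_square)
  then have e: "x * (ecomb \<kappa> (lap \<kappa> c) x)\<^sup>2 = (ecomb \<kappa> (lap \<kappa> c) x * ecomb \<kappa> (theta \<kappa> (theta \<kappa> c)) x
      - \<kappa>\<^sup>2 * ecomb \<kappa> (lap \<kappa> c) x * ecomb \<kappa> c x) / x"
    unfolding ecomb_lap[OF x] by (simp add: algebra_simps)
  show ?thesis
    unfolding flux_def[abs_def] e
    by (rule DERIV_cong[OF DERIV_diff[OF DERIV_mult[OF d d] DERIV_mult[OF d d]]])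
      (use x in \<open>simp add: l field_simps\<close>)
qed

lemma flux_mvt:
  assumes "0 < a" "a < b"
  obtains z where "a < z" "z < b" "flux \<kappa> c b - flux \<kappa> c a = (b - a) * (z * (ecomb \<kappa> (lap \<kappa> c) z)\<^sup>2)"
  using MVT2[OF assms(2), of "flux \<kappa> c" "\<lambda>x. x * (ecomb \<kappa> (lap \<kappa> c) x)\<^sup>2"]
    flux_has_real_derivative assms(1) by (metis less_le_trans)

lemma flux_le:
  assumes "0 < a" "a < b"
  shows "flux \<kappa> c a \<le> flux \<kappa> c b"
proof -
  obtain z where z: "a < z" "flux \<kappa> c b - flux \<kappa> c a = (b - a) * (z * (ecomb \<kappa> (lap \<kappa> c) z)\<^sup>2)"
    using flux_mvt[OF assms] by metis
  have "0 \<le> (b - a) * (z * (ecomb \<kappa> (lap \<kappa> c) z)\<^sup>2)" using z(1) assms by simp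
  then show ?thesis using z(2) by simp
qed

text \<open>By monotonicity the flux takes the same value at the midpoint. The mean value theorem on
  both halves yields two distinct zeros of u, which is a combination of two opposite powers and so
  vanishes.\<close>

lemma flux_eq_imp:
  assumes ab: "0 < a" "a < b" and \<kappa>: "0 < \<kappa>" and eq: "flux \<kappa> c a = flux \<kappa> c b"
  shows "c 1 = 0" "c 3 = 0"
proof -
  define m where "m = (a + b) / 2"
  have m: "a < m" "m < b" using ab by (auto simp: m_def)
  have fm: "flux \<kappa> c a = flux \<kappa> c m" "flux \<kappa> c m = flux \<kappa> c b"
    using flux_le[of a m \<kappa> c] flux_le[of m b \<kappa> c] m ab eq by auto
  obtain x where x: "a < x" "x < m" "ecomb \<kappa> (lap \<kappa> c) x = 0"
    using flux_mvt[of a m \<kappa> c] ab m fm by auto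
  obtain y where y: "m < y" "y < b" "ecomb \<kappa> (lap \<kappa> c) y = 0"
    using flux_mvt[of m b \<kappa> c] ab m fm by auto
  have e: "ecomb \<kappa> (lap \<kappa> c) z = 4 * (\<kappa> + 1) * c 1 * z powr \<kappa> + 2 * c 3 * z powr - \<kappa>" for z
    by (simp add: ecomb_def sum_lessThan_4 lap_def eb_def)
  have "4 * (\<kappa> + 1) * c 1 = 0" "2 * c 3 = 0"
    using powr_combination_two_zeros[OF \<kappa>, of x y "4 * (\<kappa> + 1) * c 1" "2 * c 3"] x y ab unfolding e by auto
  then show "c 1 = 0" "c 3 = 0" using \<kappa> by auto
qed

lemma ecomb_delta:
  "ecomb \<kappa> (delta \<kappa> c 0) x = ecomb \<kappa> c x"
  "ecomb \<kappa> (delta \<kappa> c 1) x = ecomb \<kappa> (theta \<kappa> c) x"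
  "ecomb \<kappa> (delta \<kappa> c 2) x = ecomb \<kappa> (theta \<kappa> (theta \<kappa> c)) x - ecomb \<kappa> (theta \<kappa> c) x"
  by (simp_all add: numeral_eq_Suc ecomb_def sum_subtractf algebra_simps)

text \<open>Stated for real coefficients, where the derivative of the flux is a nonnegative multiple
  of a square. \<open>C 0\<close> and \<open>C n\<close> belong to the inner and outer
  unbounded-type pieces, the remaining \<open>C j\<close> to the pieces between knots.\<close>

lemma spline_coeffs_zero_real:
  fixes C :: "nat \<Rightarrow> nat \<Rightarrow> real"
  assumes \<kappa>: "1 \<le> \<kappa>" and n: "2 \<le> n" and r1: "0 < r 1"
    and r: "\<And>j. 1 \<le> j \<Longrightarrow> j < n \<Longrightarrow> r j < r (Suc j)"
    and left: "C 0 2 = 0" "C 0 3 = 0"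
    and right: "C n 1 = 0" "C n 3 = (2 - 2 * \<kappa>) * C n 0"
    and zero: "\<And>j. 1 \<le> j \<Longrightarrow> j \<le> n \<Longrightarrow> ecomb \<kappa> (C j) (r j) = 0"
    and match: "\<And>j i. 1 \<le> j \<Longrightarrow> j \<le> n \<Longrightarrow> i < 3 \<Longrightarrow>
      ecomb \<kappa> (delta \<kappa> (C (j - 1)) i) (r j) = ecomb \<kappa> (delta \<kappa> (C j) i) (r j)"
  shows "j \<le> n \<Longrightarrow> i < 4 \<Longrightarrow> C j i = 0"
proof -
  have pos: "0 < r j" if "1 \<le> j" "j \<le> n" for j
    using that
  proof (induction j rule: dec_induct)
    case base
    then show ?case using r1 by simp
  next
    case (step j)
    then show ?case using r[of j] by simp
  qed
  have m: "ecomb \<kappa> (C (j - 1)) (r j) = 0"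
    "ecomb \<kappa> (theta \<kappa> (C (j - 1))) (r j) = ecomb \<kappa> (theta \<kappa> (C j)) (r j)"
    "ecomb \<kappa> (theta \<kappa> (theta \<kappa> (C (j - 1)))) (r j) = ecomb \<kappa> (theta \<kappa> (theta \<kappa> (C j))) (r j)"
    if "1 \<le> j" "j \<le> n" for j
    using match[OF that, of 0] match[OF that, of 1] match[OF that, of 2] zero[OF that]
    unfolding ecomb_delta by auto
  \<comment> \<open>Matching up to order two makes \<eta>, \<theta>\<eta> and u agree from both
    sides. \<theta>u may jump, but in the flux it is multiplied by \<eta>, which is zero at the
    knot.\<close>
  have fl: "flux \<kappa> (C (j - 1)) (r j) = flux \<kappa> (C j) (r j)" if j: "1 \<le> j" "j \<le> n" for j
  proof -
    have "(r j)\<^sup>2 * ecomb \<kappa> (lap \<kappa> (C (j - 1))) (r j) = (r j)\<^sup>2 * ecomb \<kappa> (lap \<kappa> (C j)) (r j)"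
      unfolding ecomb_lap[OF pos[OF j]] m[OF j] zero[OF j] by simp
    then have "ecomb \<kappa> (lap \<kappa> (C (j - 1))) (r j) = ecomb \<kappa> (lap \<kappa> (C j)) (r j)"
      using pos[OF j] by simp
    then show ?thesis unfolding flux_def m[OF j] zero[OF j] by simp
  qed
  have mono: "flux \<kappa> (C j) (r j) \<le> flux \<kappa> (C (Suc j)) (r (Suc j))" if "1 \<le> j" "j < n" for j
    using flux_le[OF pos[of j] r[OF that], of \<kappa> "C j"] fl[of "Suc j"] that by simp
  \<comment> \<open>The zero at \<open>r 1\<close> eliminates one of the two coefficients of the
    first piece; the flux becomes a positive multiple of the square of the other.\<close>
  have low1: "0 \<le> flux \<kappa> (C 0) (r 1)"
  proof -
    have z: "C 0 0 * eb \<kappa> 0 (r 1) = - (C 0 1 * eb \<kappa> 1 (r 1))"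
      using m(1)[of 1] n left by (simp add: ecomb_def sum_lessThan_4)
    have "ecomb \<kappa> (theta \<kappa> (C 0)) (r 1) = \<kappa> * (C 0 0 * eb \<kappa> 0 (r 1)) + (\<kappa> + 2) * (C 0 1 * eb \<kappa> 1 (r 1))"
      using left by (simp add: ecomb_def sum_lessThan_4 theta_def algebra_simps)
    also have "\<dots> = 2 * C 0 1 * eb \<kappa> 1 (r 1)" unfolding z by (simp add: algebra_simps)
    finally have "flux \<kappa> (C 0) (r 1)
        = 8 * (\<kappa> + 1) * ((C 0 1)\<^sup>2 * (eb \<kappa> 0 (r 1) * eb \<kappa> 1 (r 1)))"
      using m(1)[of 1] n left unfolding flux_def
      by (simp add: ecomb_def[of _ "lap _ _"] sum_lessThan_4 lap_def power2_eq_square)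
    then show ?thesis using \<kappa> by (simp add: eb_def)
  qed
  have low: "0 \<le> flux \<kappa> (C j) (r j)" if "1 \<le> j" "j \<le> n" for j
    using that
  proof (induction j rule: dec_induct)
    case base
    then show ?case using fl[of 1] n low1 by simp
  next
    case (step j)
    then show ?case using mono[of j] by simp
  qed
  \<comment> \<open>As at \<open>r 1\<close>, the zero eliminates one coefficient. The sign now
    comes from the factor 1 - \<kappa>, which is at most 0.\<close>
  have highn: "flux \<kappa> (C n) (r n) \<le> 0"
  proof -
    have rn: "0 < r n" using pos n by simp
    have z: "C n 2 * eb \<kappa> 2 (r n) = - (C n 0 * r n powr (2 - \<kappa>))"
      using zero[of n] n right unfolding powr_two_minus_eq_eb[OF rn] by (simp add: ecomb_def sum_lessThan_4 algebra_simps)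
    have "ecomb \<kappa> (theta \<kappa> (C n)) (r n)
        = (2 - \<kappa>) * (C n 0 * r n powr (2 - \<kappa>)) - \<kappa> * (C n 2 * eb \<kappa> 2 (r n))"
      unfolding powr_two_minus_eq_eb[OF rn]
      by (simp add: right ecomb_def sum_lessThan_4 theta_def algebra_simps del: One_nat_def)
    also have "\<dots> = 2 * C n 0 * r n powr (2 - \<kappa>)" unfolding z by (simp add: algebra_simps)
    finally have th: "ecomb \<kappa> (theta \<kappa> (C n)) (r n) = 2 * C n 0 * r n powr (2 - \<kappa>)" .
    have "ecomb \<kappa> (C n) (r n) = 0" using zero n by simp
    then have "flux \<kappa> (C n) (r n)
        = 8 * (1 - \<kappa>) * ((C n 0)\<^sup>2 * (eb \<kappa> 2 (r n) * r n powr (2 - \<kappa>)))"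
      unfolding flux_def th by (simp add: right ecomb_def[of _ "lap _ _"] sum_lessThan_4 lap_def
          power2_eq_square algebra_simps del: One_nat_def)
    then show ?thesis using \<kappa> by (simp add: eb_def mult_nonpos_nonneg)
  qed
  have high: "flux \<kappa> (C j) (r j) \<le> 0" if "1 \<le> j" "j \<le> n" for j
    using that(2,1)
  proof (induction j rule: inc_induct)
    case base
    then show ?case using highn by simp
  next
    case (step j)
    then show ?case using mono[of j] by simp
  qed
  have mid: "C j i = 0" if j: "1 \<le> j" "j < n" and i: "i < 4" for j i
  proof -
    have "flux \<kappa> (C j) (r j) = 0" "flux \<kappa> (C j) (r (Suc j)) = 0"
      using low[of j] high[of j] low[of "Suc j"] high[of "Suc j"] fl[of "Suc j"] j by auto
    then have c13: "C j 1 = 0" "C j 3 = 0"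
      using flux_eq_imp[of "r j" "r (Suc j)" \<kappa> "C j"] pos[of j] r[OF j] j \<kappa> by auto
    have "ecomb \<kappa> (C j) x = C j 0 * x powr \<kappa> + C j 2 * x powr - \<kappa>" for x
      using c13 by (simp add: ecomb_def sum_lessThan_4 eb_def)
    then have "C j 0 = 0" "C j 2 = 0"
      using powr_combination_two_zeros[of \<kappa> "r j" "r (Suc j)" "C j 0" "C j 2"] zero[of j] m(1)[of "Suc j"]
        pos[of j] r[OF j] j \<kappa> by auto
    moreover have "i = 0 \<or> i = 1 \<or> i = 2 \<or> i = 3" using i by linarith
    ultimately show ?thesis using c13 by auto
  qed
  have z: "ecomb \<kappa> c x = 0" "ecomb \<kappa> (theta \<kappa> c) x = 0"
    if "\<And>i. i < 4 \<Longrightarrow> c i = (0::real)" for c x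
    using that by (simp_all add: ecomb_def sum_lessThan_4 theta_def)
  \<comment> \<open>The adjacent middle piece is zero, so value and slope vanish at the end knot. In
    each outer piece the two exponents differ by 2, so these two equations determine both
    coefficients.\<close>
  have l: "C 0 i = 0" if "i < 4" for i
  proof -
    have "ecomb \<kappa> (C 0) (r 1) = 0" "ecomb \<kappa> (theta \<kappa> (C 0)) (r 1) = 0"
      using m(1,2)[of 1] n z[OF mid[of 1]] by auto
    then have "C 0 0 * eb \<kappa> 0 (r 1) = 0 \<and> C 0 1 * eb \<kappa> 1 (r 1) = 0"
      using left by (simp add: ecomb_def sum_lessThan_4 theta_def) algebra
    moreover have "i = 0 \<or> i = 1 \<or> i = 2 \<or> i = 3" using that by linarith
    ultimately show ?thesis using left r1 by (auto simp: eb_def)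
  qed
  have rr: "C n i = 0" if "i < 4" for i
  proof -
    have rn: "0 < r n" using pos n by simp
    have "ecomb \<kappa> (C n) (r n) = 0" "ecomb \<kappa> (theta \<kappa> (C n)) (r n) = 0"
      using m(1,2)[of n] zero[of n] n z[OF mid[of "n - 1"]] by auto
    then have "C n 2 * eb \<kappa> 2 (r n) + C n 0 * r n powr (2 - \<kappa>) = 0"
      "(2 - \<kappa>) * (C n 0 * r n powr (2 - \<kappa>)) - \<kappa> * (C n 2 * eb \<kappa> 2 (r n)) = 0"
      using right unfolding powr_two_minus_eq_eb[OF rn] by (simp_all add: ecomb_def sum_lessThan_4 theta_def algebra_simps)
    then have "C n 2 * eb \<kappa> 2 (r n) = 0 \<and> C n 0 * r n powr (2 - \<kappa>) = 0"
      by algebra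
    then have "C n 0 = 0" "C n 2 = 0" using rn by (auto simp: eb_def)
    moreover have "i = 0 \<or> i = 1 \<or> i = 2 \<or> i = 3" using that by linarith
    ultimately show ?thesis using right by auto
  qed
  show "j \<le> n \<Longrightarrow> i < 4 \<Longrightarrow> C j i = 0"
    using l rr mid by (metis One_nat_def Suc_leI le_neq_implies_less not_gr_zero)
qed

section \<open>Square linear systems\<close>

text \<open>Gaussian elimination by induction on the equations: a nonzero entry \<open>A q p\<close>
  of the new equation removes the unknown \<open>p\<close> from all others, leaving one equation and
  one unknown fewer.\<close>

lemma underdetermined_system_solution:
  fixes A :: "'j \<Rightarrow> 'i \<Rightarrow> 'a::field"
  assumes "finite J" "finite I" "card J < card I"
  obtains x where "\<And>j. j \<in> J \<Longrightarrow> (\<Sum>i\<in>I. A j i * x i) = 0" "\<exists>i\<in>I. x i \<noteq> 0"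
proof -
  have "\<exists>x. (\<forall>j\<in>J. (\<Sum>i\<in>I. A j i * x i) = 0) \<and> (\<exists>i\<in>I. x i \<noteq> 0)"
    using assms
  proof (induction J arbitrary: I A rule: finite_induct)
    case empty
    then have "I \<noteq> {}" by auto
    then show ?case by (intro exI[of _ "\<lambda>_. 1"]) auto
  next
    case (insert q J)
    show ?case
    proof (cases "\<forall>i\<in>I. A q i = 0")
      case True
      then show ?thesis using insert.IH[of I A] insert.prems insert.hyps by auto
    next
      case False
      then obtain p where p: "p \<in> I" "A q p \<noteq> 0" by blast
      define A' where "A' j i = A j i - A j p / A q p * A q i" for j i
      have "card J < card (I - {p})"
        using insert.prems insert.hyps p by simp
      then obtain x where x: "\<forall>j\<in>J. (\<Sum>i\<in>I - {p}. A' j i * x i) = 0" "\<exists>i\<in>I - {p}. x i \<noteq> 0"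
        using insert.IH[of "I - {p}" A'] insert.prems by auto
      \<comment> \<open>The value at \<open>p\<close> is chosen so that equation \<open>q\<close>
        holds.\<close>
      define y where "y = x(p := - (\<Sum>i\<in>I - {p}. A q i * x i) / A q p)"
      have y: "(\<Sum>i\<in>I. A j i * y i)
          = (\<Sum>i\<in>I - {p}. A j i * x i) - A j p / A q p * (\<Sum>i\<in>I - {p}. A q i * x i)" for j
      proof -
        have "(\<Sum>i\<in>I. A j i * y i) = A j p * y p + (\<Sum>i\<in>I - {p}. A j i * y i)"
          using insert.prems(1) p(1) by (rule sum.remove)
        also have "(\<Sum>i\<in>I - {p}. A j i * y i) = (\<Sum>i\<in>I - {p}. A j i * x i)"
          by (rule sum.cong) (auto simp: y_def)
        finally show ?thesis by (simp add: y_def)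
      qed
      have "(\<Sum>i\<in>I. A q i * y i) = 0" using p unfolding y by simp
      moreover have "(\<Sum>i\<in>I. A j i * y i) = 0" if "j \<in> J" for j
        using x(1) that unfolding y
        by (simp add: A'_def left_diff_distrib sum_subtractf sum_distrib_left mult.assoc)
      moreover have "\<exists>i\<in>I. y i \<noteq> 0" using x(2) by (auto simp: y_def)
      ultimately show ?thesis by (intro exI[of _ y]) simp
    qed
  qed
  then show ?thesis using that by blast
qed

text \<open>With the right-hand side as an additional column there are more unknowns than equations,
  hence a nontrivial solution. Injectivity keeps its additional component away from zero, and
  rescaling by that component solves the system.\<close>

lemma injective_linear_solvable:
  fixes T :: "('i \<Rightarrow> 'a::field) \<Rightarrow> 'i \<Rightarrow> 'a"
  assumes fin: "finite I"
    and add: "\<And>x y i. T (\<lambda>j. x j + y j) i = T x i + T y i"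
    and scale: "\<And>a x i. T (\<lambda>j. a * x j) i = a * T x i"
    and inj: "\<And>x j. (\<And>i. i \<in> I \<Longrightarrow> T x i = 0) \<Longrightarrow> j \<in> I \<Longrightarrow> x j = 0"
  obtains x where "\<And>i. i \<in> I \<Longrightarrow> T x i = b i"
proof -
  define e where "e m = (\<lambda>j. if j = m then 1 else (0::'a))" for m :: 'i
  \<comment> \<open>\<open>comb y\<close> agrees with \<open>y\<close> on \<open>I\<close> and is 0
    elsewhere, so on it \<open>T\<close> acts through the finite matrix
    \<open>T (e m) i\<close>.\<close>
  define comb where "comb y j = (\<Sum>m\<in>I. y m * e m j)" for y j
  have z: "T (\<lambda>j. 0) i = 0" for i using scale[of 0 "\<lambda>j. 0" i] by simp
  have "T (\<lambda>j. \<Sum>m\<in>M. y m * e m j) i = (\<Sum>m\<in>M. T (e m) i * y m)" if "finite M" for M y i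
    using that
  proof (induction M)
    case empty
    then show ?case by (simp add: z)
  next
    case (insert m M)
    then show ?case
      using add[of "\<lambda>j. y m * e m j" "\<lambda>j. \<Sum>m\<in>M. y m * e m j" i] scale[of "y m" "e m" i]
      by (simp add: mult.commute)
  qed
  then have lin: "T (comb y) i = (\<Sum>m\<in>I. T (e m) i * y m)" for y i
    using fin by (simp add: comb_def[abs_def])
  have at: "comb y j = y j" if "j \<in> I" for y j
    using fin that by (simp add: comb_def e_def if_distrib cong: if_cong)
  \<comment> \<open>The right-hand side becomes the column of one additional unknown \<open>None\<close>.\<close>
  define A where "A i p = (case p of None \<Rightarrow> - b i | Some m \<Rightarrow> T (e m) i)" for i p
  have "card I < card (insert None (Some ` I))"
    using fin by (simp add: card_image)
  then obtain x where "\<And>i. i \<in> I \<Longrightarrow> (\<Sum>p\<in>insert None (Some ` I). A i p * x p) = 0"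
    and nz: "\<exists>p\<in>insert None (Some ` I). x p \<noteq> 0"
    using underdetermined_system_solution[of I "insert None (Some ` I)" A] fin by auto
  then have x: "T (comb (\<lambda>m. x (Some m))) i = b i * x None" if "i \<in> I" for i
    using fin that unfolding lin by (simp add: A_def sum.reindex)
  have "x None \<noteq> 0"
  proof
    assume n: "x None = 0"
    then have "comb (\<lambda>m. x (Some m)) j = 0" if "j \<in> I" for j
      using inj[OF _ that, of "comb (\<lambda>m. x (Some m))"] x by simp
    then show False using nz n at[of _ "\<lambda>m. x (Some m)"] by auto
  qed
  then have "T (\<lambda>j. 1 / x None * comb (\<lambda>m. x (Some m)) j) i = b i" if "i \<in> I" for i
    unfolding scale using x[OF that] by simp
  then show ?thesis by (rule that)
qed

section \<open>Splines and their coefficients\<close>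

text \<open>
  \<open>C j\<close> are the coefficients between the \<open>j\<close>-th and the \<open>(j+1)\<close>-st knot. The conditions on \<open>C n\<close>
  select the null space of \<open>R\<^sub>k\<close>, because \<open>r\<^bsup>2-\<kappa>\<^esup> = eb \<kappa> 0 + (2 - 2\<kappa>) eb \<kappa> 3\<close>.
\<close>

definition spline_coeffs :: "real \<Rightarrow> nat \<Rightarrow> (nat \<Rightarrow> real) \<Rightarrow> (nat \<Rightarrow> nat \<Rightarrow> complex) \<Rightarrow> bool" where
  "spline_coeffs \<kappa> n r C \<longleftrightarrow>
     C 0 2 = 0 \<and> C 0 3 = 0 \<and> C n 1 = 0 \<and> C n 3 = of_real (2 - 2 * \<kappa>) * C n 0 \<and>
     (\<forall>j\<in>{1..n}. \<forall>i<3. ecomb \<kappa> (delta \<kappa> (C (j - 1)) i) (r j) = ecomb \<kappa> (delta \<kappa> (C j) i) (r j))"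

lemma Re_ecomb: "Re (ecomb \<kappa> c x) = ecomb \<kappa> (\<lambda>i. Re (c i)) x"
  and Im_ecomb: "Im (ecomb \<kappa> c x) = ecomb \<kappa> (\<lambda>i. Im (c i)) x"
  by (simp_all add: ecomb_def)

lemma Re_delta: "(\<lambda>j. Re (delta \<kappa> c m j)) = delta \<kappa> (\<lambda>i. Re (c i)) m"
  and Im_delta: "(\<lambda>j. Im (delta \<kappa> c m j)) = delta \<kappa> (\<lambda>i. Im (c i)) m"
proof (induction m)
  case (Suc m)
  have "Re (delta \<kappa> c m j) = delta \<kappa> (\<lambda>i. Re (c i)) m j"
    "Im (delta \<kappa> c m j) = delta \<kappa> (\<lambda>i. Im (c i)) m j" for j
    using Suc.IH by (auto dest: fun_cong)
  note s = this[symmetric]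
  {
    case 1
    then show ?case by (simp add: theta_def s fun_eq_iff)
  next
    case 2
    then show ?case by (simp add: theta_def s fun_eq_iff)
  }
qed simp_all

lemma delta_add: "delta \<kappa> (\<lambda>i. c i + d i) m = (\<lambda>j. delta \<kappa> c m j + delta \<kappa> d m j)"
  by (induction m) (simp_all add: theta_def fun_eq_iff algebra_simps)

lemma delta_scale: "delta \<kappa> (\<lambda>i. a * c i) m = (\<lambda>j. a * delta \<kappa> c m j)"
  by (induction m) (simp_all add: theta_def fun_eq_iff algebra_simps)

lemma ecomb_add: "ecomb \<kappa> (\<lambda>j. c j + d j) x = ecomb \<kappa> c x + ecomb \<kappa> d x"
  by (simp add: ecomb_def sum_lessThan_4 algebra_simps)

lemma ecomb_scale: "ecomb \<kappa> (\<lambda>j. a * c j) x = a * ecomb \<kappa> c x"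
  by (simp add: ecomb_def sum_lessThan_4 algebra_simps)

text \<open>All conditions are linear with real data, so the real and the imaginary parts of the
  coefficients satisfy them separately.\<close>

lemma spline_coeffs_zero:
  assumes \<kappa>: "1 \<le> \<kappa>" and n: "2 \<le> n" and r1: "0 < r 1"
    and r: "\<And>j. 1 \<le> j \<Longrightarrow> j < n \<Longrightarrow> r j < r (Suc j)"
    and C: "spline_coeffs \<kappa> n r C"
    and zero: "\<And>j. 1 \<le> j \<Longrightarrow> j \<le> n \<Longrightarrow> ecomb \<kappa> (C j) (r j) = 0"
    and ji: "j \<le> n" "i < 4"
  shows "C j i = 0"
proof -
  have match: "ecomb \<kappa> (delta \<kappa> (C (j - 1)) i) (r j) = ecomb \<kappa> (delta \<kappa> (C j) i) (r j)"
    if "1 \<le> j" "j \<le> n" "i < 3" for i j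
    using C that by (auto simp: spline_coeffs_def)
  have "Re (C j i) = 0"
    by (rule spline_coeffs_zero_real[OF \<kappa> n r1 r _ _ _ _ _ _ ji, where C = "\<lambda>j i. Re (C j i)"])
      (use C zero match in \<open>simp_all add: spline_coeffs_def Re_ecomb[symmetric] Re_delta[symmetric]\<close>)
  moreover have "Im (C j i) = 0"
    by (rule spline_coeffs_zero_real[OF \<kappa> n r1 r _ _ _ _ _ _ ji, where C = "\<lambda>j i. Im (C j i)"])
      (use C zero match in \<open>simp_all add: spline_coeffs_def Im_ecomb[symmetric] Im_delta[symmetric]\<close>)
  ultimately show ?thesis by (simp add: complex_eq_iff)
qed

lemma spline_coeffs_unique:
  assumes \<kappa>: "1 \<le> \<kappa>" and n: "2 \<le> n" and r1: "0 < r 1"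
    and r: "\<And>j. 1 \<le> j \<Longrightarrow> j < n \<Longrightarrow> r j < r (Suc j)"
    and C: "spline_coeffs \<kappa> n r C" and D: "spline_coeffs \<kappa> n r D"
    and eq: "\<And>j. 1 \<le> j \<Longrightarrow> j \<le> n \<Longrightarrow> ecomb \<kappa> (C j) (r j) = ecomb \<kappa> (D j) (r j)"
    and ji: "j \<le> n" "i < 4"
  shows "C j i = D j i"
proof -
  \<comment> \<open>The difference is written with the factor -1 so that additivity and homogeneity
    of \<open>delta\<close> and \<open>ecomb\<close> apply literally.\<close>
  define E where "E j i = C j i + (- 1) * D j i" for j i
  have lin: "delta \<kappa> (E j) m = (\<lambda>i. delta \<kappa> (C j) m i + (- 1) * delta \<kappa> (D j) m i)"
    "ecomb \<kappa> (\<lambda>i. c i + (- 1) * d i) x = ecomb \<kappa> c x + (- 1) * ecomb \<kappa> d x"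
    for j m x and c d :: "nat \<Rightarrow> complex"
    unfolding E_def[abs_def] by (simp_all only: delta_add delta_scale ecomb_add ecomb_scale)
  have "spline_coeffs \<kappa> n r E"
    unfolding spline_coeffs_def lin using C D
    by (auto simp: spline_coeffs_def E_def algebra_simps)
  moreover have "ecomb \<kappa> (E j) (r j) = 0" if "1 \<le> j" "j \<le> n" for j
    using eq[OF that] lin(2)[of "C j" "D j"] by (simp add: E_def[abs_def])
  ultimately have "E j i = 0"
    using spline_coeffs_zero[OF \<kappa> n r1 r, of E j i] ji by blast
  then show ?thesis by (simp add: E_def)
qed

text \<open>There are 4(n + 1) unknown coefficients, four end conditions, and at each of the n knots
  three matching conditions and one prescribed value. The system is square, and
  \<open>spline_coeffs_zero\<close> is its injectivity.\<close>

lemma spline_coeffs_exist: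
  assumes \<kappa>: "1 \<le> \<kappa>" and n: "2 \<le> n" and r1: "0 < r 1"
    and r: "\<And>j. 1 \<le> j \<Longrightarrow> j < n \<Longrightarrow> r j < r (Suc j)"
  obtains C where "spline_coeffs \<kappa> n r C" "\<And>j. 1 \<le> j \<Longrightarrow> j \<le> n \<Longrightarrow> ecomb \<kappa> (C j) (r j) = \<nu> j"
proof -
  \<comment> \<open>Equations and unknowns share one index set. Row \<open>j = 0\<close> holds the
    four end conditions; row \<open>j > 0\<close> holds the matching conditions at
    \<open>r j\<close> for \<open>e < 3\<close> and the value there for
    \<open>e = 3\<close>.\<close>
  define T :: "(nat \<times> nat \<Rightarrow> complex) \<Rightarrow> nat \<times> nat \<Rightarrow> complex" where
    "T c = (\<lambda>(j, e). if j = 0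
        then (if e = 0 then c (0, 2) else if e = 1 then c (0, 3) else if e = 2 then c (n, 1)
              else c (n, 3) - of_real (2 - 2 * \<kappa>) * c (n, 0))
        else if e = 3 then ecomb \<kappa> (\<lambda>i. c (j, i)) (r j)
        else ecomb \<kappa> (delta \<kappa> (\<lambda>i. c (j, i)) e) (r j)
           - ecomb \<kappa> (delta \<kappa> (\<lambda>i. c (j - 1, i)) e) (r j))" for c
  define b where "b = (\<lambda>(j, e). if j \<noteq> 0 \<and> e = (3::nat) then \<nu> j else 0)"
  have sc: "spline_coeffs \<kappa> n r (\<lambda>j i. c (j, i))"
    if z: "\<And>j e. j \<le> n \<Longrightarrow> e < 4 \<Longrightarrow> j = 0 \<or> e \<noteq> 3 \<Longrightarrow> T c (j, e) = 0" for c
  proof -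
    have "T c (0, 0) = 0" "T c (0, 1) = 0" "T c (0, 2) = 0" "T c (0, 3) = 0"
      using z by auto
    moreover have "T c (j, i) = 0" if "j \<in> {1..n}" "i < 3" for j i
      using z that by simp
    ultimately show ?thesis
      unfolding spline_coeffs_def by (simp add: T_def)
  qed
  have val: "ecomb \<kappa> (\<lambda>i. c (j, i)) (r j) = T c (j, 3)" if "1 \<le> j" for c j
    using that by (simp add: T_def)
  obtain c where c: "\<And>p. p \<in> {0..n} \<times> {..<4} \<Longrightarrow> T c p = b p"
  proof (rule injective_linear_solvable[of "{0..n} \<times> {..<4}" T b])
    show "T (\<lambda>p. c p + d p) p = T c p + T d p" for c d p
      by (simp add: T_def delta_add ecomb_add algebra_simps split: prod.split)
    show "T (\<lambda>p. a * c p) p = a * T c p" for a c p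
      by (simp add: T_def delta_scale ecomb_scale algebra_simps split: prod.split)
    show "c p = 0" if z: "\<And>p. p \<in> {0..n} \<times> {..<4} \<Longrightarrow> T c p = 0" and p: "p \<in> {0..n} \<times> {..<4}" for c p
    proof -
      have "spline_coeffs \<kappa> n r (\<lambda>j i. c (j, i))"
        by (rule sc, rule z) simp
      moreover have "ecomb \<kappa> (\<lambda>i. c (j, i)) (r j) = 0" if "1 \<le> j" "j \<le> n" for j
        using val[OF that(1)] z[of "(j, 3)"] that by simp
      ultimately have "c (fst p, snd p) = 0"
        using spline_coeffs_zero[OF \<kappa> n r1 r, of "\<lambda>j i. c (j, i)" "fst p" "snd p"] p by auto
      then show ?thesis by simp
    qed
  qed auto
  show ?thesis
  proof (rule that)
    show "spline_coeffs \<kappa> n r (\<lambda>j i. c (j, i))"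
      by (rule sc, subst c) (auto simp: b_def)
    show "ecomb \<kappa> (\<lambda>i. c (j, i)) (r j) = \<nu> j" if "1 \<le> j" "j \<le> n" for j
      using val[OF that(1)] c[of "(j, 3)"] that by (simp add: b_def)
  qed
qed

text \<open>\<open>r 0\<close> is not a knot and may be any number, so the left end of piece 0 is
  set to 0 explicitly; piece \<open>n\<close> has no right end.\<close>

definition knot_interval :: "nat \<Rightarrow> (nat \<Rightarrow> real) \<Rightarrow> nat \<Rightarrow> real set" where
  "knot_interval n r j = {x. (if j = 0 then 0 else r j) < x \<and> (j < n \<longrightarrow> x < r (Suc j))}"

lemma knot_interval_cases:
  "knot_interval n r j = (if j < n then {(if j = 0 then 0 else r j)<..<r (Suc j)}
     else {(if j = 0 then 0 else r j)<..})"
  by (auto simp: knot_interval_def)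

lemma open_knot_interval: "open (knot_interval n r j)"
  and convex_knot_interval: "convex (knot_interval n r j)"
  by (simp_all add: knot_interval_cases)

lemma knots_pos:
  assumes "0 < r 1" "\<And>j. 1 \<le> j \<Longrightarrow> j < n \<Longrightarrow> r j < (r (Suc j) :: real)" "1 \<le> j" "j \<le> n"
  shows "0 < r j"
  using assms(3,4)
proof (induction j rule: dec_induct)
  case base
  then show ?case using assms by simp
next
  case (step j)
  then show ?case using assms(2)[of j] by simp
qed

lemma positive_cases_knot:
  assumes x: "0 < (x::real)"
  obtains j where "j \<le> n" "x \<in> knot_interval n r j" | j where "1 \<le> j" "j \<le> n" "x = r j"
proof -
  define A where "A = {i. 1 \<le> i \<and> i \<le> n \<and> r i \<le> x}"
  have A: "finite A" by (auto simp: A_def)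
  show ?thesis
  proof (cases "A = {}")
    case True
    then have "1 \<notin> A" by simp
    then have "x \<in> knot_interval n r 0" using x by (auto simp: A_def knot_interval_def)
    then show ?thesis using that(1)[of 0] by simp
  next
    case False
    define j where "j = Max A"
    have j: "j \<in> A" "Suc j \<notin> A" using Max_in[OF A False] Max_ge[OF A, of "Suc j"] by (auto simp: j_def)
    then have "r j = x \<or> x \<in> knot_interval n r j" by (auto simp: A_def knot_interval_def)
    then show ?thesis using that j(1) by (auto simp: A_def)
  qed
qed

text \<open>The closures of the two half-lines meet only in \<open>a\<close>, so agreement of values
  and derivatives at that point suffices. This is how adjacent pieces are joined at a knot.\<close>

lemma has_vector_derivative_glue:
  fixes f g :: "real \<Rightarrow> 'a::real_normed_vector"
  assumes f: "x \<le> a \<Longrightarrow> (f has_vector_derivative f' x) (at x)"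
    and g: "a \<le> x \<Longrightarrow> (g has_vector_derivative g' x) (at x)"
    and eq: "f a = g a" "f' a = g' a"
  shows "((\<lambda>x. if x \<le> a then f x else g x) has_vector_derivative (if x \<le> a then f' x else g' x)) (at x)"
proof -
  have c: "closure {..a} \<inter> closure {a<..} = {a}" by auto
  have "((\<lambda>x. if x \<in> {..a} then f x else g x) has_vector_derivative
      (if x \<in> {..a} then f' x else g' x)) (at x within UNIV)"
    by (rule has_vector_derivative_If_within_closures[where T = "{a<..}"])
      (use f g eq in \<open>auto simp: c intro: has_vector_derivative_at_within\<close>)
  then show ?thesis by simp
qed

lemma ecomb_delta_over_power_continuous:
  fixes c :: "nat \<Rightarrow> 'a::real_normed_field"
  assumes "0 < x"
  shows "isCont (\<lambda>x. ecomb \<kappa> (delta \<kappa> c m) x / of_real x ^ m) x"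
  using ecomb_chain[OF assms, of \<kappa> c m] has_vector_derivative_continuous by blast

text \<open>The null space lemmas supply coefficients on every piece. The matching conditions result
  from comparing one-sided limits of the derivatives at the knots.\<close>

lemma spline_imp_coeffs:
  assumes k: "k \<noteq> 0" and n: "2 \<le> n" and r1: "0 < r 1"
    and r: "\<And>j. 1 \<le> j \<Longrightarrow> j < n \<Longrightarrow> r j < r (Suc j)"
    and \<eta>: "\<eta> \<in> beppo_levi_splines k n r"
  obtains C where "spline_coeffs \<bar>real_of_int k\<bar> n r C"
    "\<And>j x. j \<le> n \<Longrightarrow> x \<in> knot_interval n r j \<Longrightarrow> \<eta> x = ecomb \<bar>real_of_int k\<bar> (C j) x"
    "\<And>j. 1 \<le> j \<Longrightarrow> j \<le> n \<Longrightarrow> \<eta> (r j) = ecomb \<bar>real_of_int k\<bar> (C j) (r j)"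
proof -
  define \<kappa> where "\<kappa> = \<bar>real_of_int k\<bar>"
  have pos: "0 < r j" if "1 \<le> j" "j \<le> n" for j
    using knots_pos[of r n j] r1 r that by blast
  have "\<exists>c. (\<forall>x\<in>knot_interval n r j. \<eta> x = ecomb \<kappa> c x) \<and> (j = 0 \<longrightarrow> c 2 = 0 \<and> c 3 = 0)
      \<and> (j = n \<longrightarrow> c 1 = 0 \<and> c 3 = of_real (2 - 2 * \<kappa>) * c 0)" if j: "j \<le> n" for j
  proof -
    have sub: "knot_interval n r j \<subseteq> {0<..}"
      using pos[of j] j by (auto simp: knot_interval_def split: if_splits)
    consider "j = 0" | "j = n" | "1 \<le> j" "j < n" using j by linarith
    then show ?thesis
    proof cases
      case 1
      have I: "knot_interval n r j = {0<..<r 1}" using n by (simp add: knot_interval_cases 1)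
      have "times_differentiable_on 2 \<eta> (knot_interval n r j)"
        "\<And>x. x \<in> knot_interval n r j \<Longrightarrow> G_op k \<eta> x = 0"
        using \<eta> unfolding I beppo_levi_splines_def by simp_all
      then obtain c where "\<And>x. x \<in> knot_interval n r j \<Longrightarrow> \<eta> x = ecomb \<kappa> c x" "c 2 = 0" "c 3 = 0"
        using G_op_zero_imp_ecomb[OF convex_knot_interval sub, where k = k and f = \<eta>]
        unfolding \<kappa>_def by metis
      then show ?thesis using n 1 by auto
    next
      case 2
      have I: "knot_interval n r j = {r n<..}" using n by (simp add: knot_interval_cases 2)
      have "times_differentiable_on 2 \<eta> (knot_interval n r j)"
        "\<And>x. x \<in> knot_interval n r j \<Longrightarrow> R_op k \<eta> x = 0"
        using \<eta> unfolding I beppo_levi_splines_def by simp_all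
      then obtain c where "\<And>x. x \<in> knot_interval n r j \<Longrightarrow> \<eta> x = ecomb \<kappa> c x" "c 1 = 0"
        "c 3 = of_real (2 - 2 * \<kappa>) * c 0"
        using R_op_zero_imp_ecomb[OF convex_knot_interval sub, where k = k and f = \<eta>]
        unfolding \<kappa>_def by metis
      then show ?thesis using n 2 by auto
    next
      case 3
      have I: "knot_interval n r j = {r j<..<r (j + 1)}" using 3 by (simp add: knot_interval_cases)
      have "times_differentiable_on 4 \<eta> (knot_interval n r j)"
        "\<And>x. x \<in> knot_interval n r j \<Longrightarrow> L_op k \<eta> x = 0"
        using \<eta> 3 unfolding I beppo_levi_splines_def by simp_all
      then obtain c where "\<And>x. x \<in> knot_interval n r j \<Longrightarrow> \<eta> x = ecomb \<kappa> c x"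
        using L_op_zero_imp_ecomb[OF convex_knot_interval sub k, where f = \<eta>]
        unfolding \<kappa>_def by metis
      then show ?thesis using 3 by auto
    qed
  qed
  then obtain C where
      C: "\<And>j x. j \<le> n \<Longrightarrow> x \<in> knot_interval n r j \<Longrightarrow> \<eta> x = ecomb \<kappa> (C j) x"
    and left: "C 0 2 = 0" "C 0 3 = 0"
    and right: "C n 1 = 0" "C n 3 = of_real (2 - 2 * \<kappa>) * C n 0"
    by (metis order_refl zero_le)
  have deriv: "nth_vderiv i \<eta> x = ecomb \<kappa> (delta \<kappa> (C j) i) x / of_real x ^ i"
    if j: "j \<le> n" and x: "x \<in> knot_interval n r j" for i j x
  proof (rule nth_vderiv_chain[OF open_knot_interval, where m = i
        and g = "\<lambda>i x. ecomb \<kappa> (delta \<kappa> (C j) i) x / of_real x ^ i"])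
    show "\<eta> x = ecomb \<kappa> (delta \<kappa> (C j) 0) x / of_real x ^ 0" if "x \<in> knot_interval n r j" for x
      using C[OF j that] by simp
    show "((\<lambda>x. ecomb \<kappa> (delta \<kappa> (C j) i) x / of_real x ^ i) has_vector_derivative
        ecomb \<kappa> (delta \<kappa> (C j) (Suc i)) x / of_real x ^ Suc i) (at x)"
      if "x \<in> knot_interval n r j" for i x
      using that pos[of j] j by (intro ecomb_chain) (auto simp: knot_interval_def split: if_splits)
  qed (use x in auto)
  have knot: "nth_vderiv i \<eta> (r j) = ecomb \<kappa> (delta \<kappa> (C (j - 1)) i) (r j) / of_real (r j) ^ i
      \<and> nth_vderiv i \<eta> (r j) = ecomb \<kappa> (delta \<kappa> (C j) i) (r j) / of_real (r j) ^ i"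
    if j: "1 \<le> j" "j \<le> n" and i: "i < 3" for i j
  proof -
    have "C2_at \<eta> (r j)" using \<eta> j by (auto simp: beppo_levi_splines_def)
    then obtain U where U: "open U" "r j \<in> U" "times_differentiable_on 2 \<eta> U"
      "continuous_on U (nth_vderiv 2 \<eta>)" unfolding C2_at_def by blast
    \<comment> \<open>Continuity is part of \<open>C2_at\<close> for order 2 and follows from
      differentiability for orders 0 and 1.\<close>
    have "isCont (nth_vderiv i \<eta>) (r j)"
    proof (cases "i = 2")
      case True
      then show ?thesis using U continuous_on_eq_continuous_at by blast
    next
      case False
      then have "nth_vderiv i \<eta> differentiable at (r j)"
        using U i by (auto simp: times_differentiable_on_def)
      then show ?thesis by (rule differentiable_imp_continuous_within)
    qed
    then have lim: "(nth_vderiv i \<eta> \<longlongrightarrow> nth_vderiv i \<eta> (r j)) (at (r j))"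
      by (simp add: isCont_def)
    have lim': "((\<lambda>x. ecomb \<kappa> (delta \<kappa> c i) x / of_real x ^ i) \<longlongrightarrow>
        ecomb \<kappa> (delta \<kappa> c i) (r j) / of_real (r j) ^ i) (at (r j))" for c :: "nat \<Rightarrow> complex"
      using ecomb_delta_over_power_continuous[OF pos[OF j]] by (simp add: isCont_def)
    have "eventually (\<lambda>x. x \<in> {(if j = 1 then 0 else r (j - 1))<..<r j}) (at_left (r j))"
      using pos[OF j] r[of "j - 1"] j by (intro eventually_at_left_real) auto
    then have evl: "eventually (\<lambda>x. nth_vderiv i \<eta> x
        = ecomb \<kappa> (delta \<kappa> (C (j - 1)) i) x / of_real x ^ i) (at_left (r j))"
      by eventually_elim (rule deriv, use j in \<open>auto simp: knot_interval_def split: if_splits\<close>)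
    \<comment> \<open>To the right of the last knot there is no next one, so \<open>r j + 1\<close>
      is an arbitrary bound.\<close>
    have "eventually (\<lambda>x. x \<in> {r j<..<(if j = n then r j + 1 else r (Suc j))}) (at_right (r j))"
      using r[of j] j by (intro eventually_at_right_real) auto
    then have evr: "eventually (\<lambda>x. nth_vderiv i \<eta> x
        = ecomb \<kappa> (delta \<kappa> (C j) i) x / of_real x ^ i) (at_right (r j))"
      by eventually_elim (rule deriv, use j in \<open>auto simp: knot_interval_def split: if_splits\<close>)
    note le = filterlim_mono[OF _ order_refl at_le[OF subset_UNIV]]
    show ?thesis
    proof
      show "nth_vderiv i \<eta> (r j) = ecomb \<kappa> (delta \<kappa> (C (j - 1)) i) (r j) / of_real (r j) ^ i"
        using tendsto_unique[OF trivial_limit_at_left_real le[OF lim]]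
          tendsto_cong[OF evl] le[OF lim'] by blast
      show "nth_vderiv i \<eta> (r j) = ecomb \<kappa> (delta \<kappa> (C j) i) (r j) / of_real (r j) ^ i"
        using tendsto_unique[OF trivial_limit_at_right_real le[OF lim]]
          tendsto_cong[OF evr] le[OF lim'] by blast
    qed
  qed
  have "ecomb \<kappa> (delta \<kappa> (C (j - 1)) i) (r j) = ecomb \<kappa> (delta \<kappa> (C j) i) (r j)"
    if "1 \<le> j" "j \<le> n" "i < 3" for i j
    using knot[OF that] pos[of j] that by auto
  then have "spline_coeffs \<kappa> n r C"
    using left right by (simp add: spline_coeffs_def)
  moreover have "\<eta> (r j) = ecomb \<kappa> (C j) (r j)" if "1 \<le> j" "j \<le> n" for j
    using conjunct2[OF knot[OF that, of 0]] by (simp add: nth_vderiv_def)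
  ultimately show ?thesis using that C unfolding \<kappa>_def by blast
qed

lemma coeffs_imp_spline:
  assumes k: "k \<noteq> 0" and n: "2 \<le> n" and r1: "0 < r 1"
    and r: "\<And>j. 1 \<le> j \<Longrightarrow> j < n \<Longrightarrow> r j < r (Suc j)"
    and C: "spline_coeffs \<bar>real_of_int k\<bar> n r C"
  obtains \<eta> where "\<eta> \<in> beppo_levi_splines k n r"
    "\<And>j. 1 \<le> j \<Longrightarrow> j \<le> n \<Longrightarrow> \<eta> (r j) = ecomb \<bar>real_of_int k\<bar> (C j) (r j)"
proof -
  define \<kappa> where "\<kappa> = \<bar>real_of_int k\<bar>"
  have \<kappa>: "1 \<le> \<kappa>" using k unfolding \<kappa>_def by linarith
  have pos: "0 < r j" if "1 \<le> j" "j \<le> n" for j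
    using knots_pos[of r n j] r1 r that by blast
  have r_mono: "r i \<le> r j" if "1 \<le> i" "i \<le> j" "j \<le> n" for i j
    using that(2,3)
  proof (induction j rule: dec_induct)
    case (step m)
    then show ?case using r[of m] that(1) by simp
  qed simp
  \<comment> \<open>The number of knots not exceeding \<open>x\<close> is the index of its piece; a
    knot is thereby assigned to the piece on its right.\<close>
  define idx where "idx x = card {i. 1 \<le> i \<and> i \<le> n \<and> r i \<le> x}" for x
  have idx: "idx x = j" if "j \<le> n" "j = 0 \<or> r j \<le> x" "j < n \<Longrightarrow> x < r (Suc j)" for j x
  proof -
    have "{i. 1 \<le> i \<and> i \<le> n \<and> r i \<le> x} = {1..j}"
    proof (intro equalityI subsetI)
      fix i assume i: "i \<in> {i. 1 \<le> i \<and> i \<le> n \<and> r i \<le> x}"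
      have "\<not> j < i"
      proof
        assume "j < i"
        then show False using r_mono[of "Suc j" i] i that(3) by simp
      qed
      then show "i \<in> {1..j}" using i by simp
    next
      fix i assume "i \<in> {1..j}"
      then show "i \<in> {i. 1 \<le> i \<and> i \<le> n \<and> r i \<le> x}" using r_mono[of i j] that by force
    qed
    then show ?thesis by (simp add: idx_def)
  qed
  define \<eta> where "\<eta> x = (if x < 0 then undefined else if x = 0 then 0
    else ecomb \<kappa> (C (idx x)) x)" for x
  define E where "E j i x = ecomb \<kappa> (delta \<kappa> (C j) i) x / complex_of_real x ^ i" for j i x
  have dE: "(E j i has_vector_derivative E j (Suc i) x) (at x)" if "0 < x" for j i x
    unfolding E_def[abs_def] by (rule ecomb_chain[OF that])
  have \<eta>E: "\<eta> x = E j 0 x" if "j \<le> n" "x \<in> knot_interval n r j" for j x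
    using that pos[of j] idx[of j x] by (cases "j = 0") (auto simp: \<eta>_def E_def knot_interval_def)
  have \<eta>r: "\<eta> (r j) = E j 0 (r j)" if "1 \<le> j" "j \<le> n" for j
    using that pos[of j] idx[of j "r j"] r[of j] by (auto simp: \<eta>_def E_def)
  have ipos: "0 < x" if "j \<le> n" "x \<in> knot_interval n r j" for j x
    using that pos[of j] by (auto simp: knot_interval_def split: if_splits)
  have I: "times_differentiable_on m \<eta> (knot_interval n r j)" if "j \<le> n" for m j
    by (rule times_differentiable_on_chain[OF open_knot_interval, where g = "E j"])
      (use \<eta>E dE ipos that in blast)+
  have D: "nth_vderiv i \<eta> x = E j i x" if "j \<le> n" "x \<in> knot_interval n r j" for i j x
    by (rule nth_vderiv_chain[OF open_knot_interval, where g = "E j" and m = i])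
      (use \<eta>E dE ipos that in blast)+
  have match: "E (j - 1) i (r j) = E j i (r j)" if "1 \<le> j" "j \<le> n" "i < 3" for i j
    using C that by (simp add: spline_coeffs_def E_def \<kappa>_def)
  have c2: "C2_at \<eta> (r j)" if j: "1 \<le> j" "j \<le> n" for j
  proof -
    \<comment> \<open>This neighbourhood contains no knot besides \<open>r j\<close>. At
      \<open>r j\<close> itself \<open>g\<close> uses the left piece and \<open>\<eta>\<close> the
      right one, which agree by \<open>match\<close>.\<close>
    define U where "U = {x. (if j = 1 then 0 else r (j - 1)) < x \<and> (j < n \<longrightarrow> x < r (Suc j))}"
    define g where "g i x = (if x \<le> r j then E (j - 1) i x else E j i x)" for i x
    have "U = (if j < n then {(if j = 1 then 0 else r (j - 1))<..<r (Suc j)}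
        else {(if j = 1 then 0 else r (j - 1))<..})" by (auto simp: U_def)
    then have oU: "open U" by simp
    have rU: "r j \<in> U" using pos[OF j] r[of j] r[of "j - 1"] j by (auto simp: U_def)
    have Upos: "0 < x" if "x \<in> U" for x
    proof (cases "j = 1")
      case False
      then have "0 < r (j - 1)" using j by (intro pos) auto
      then show ?thesis using that False by (auto simp: U_def)
    qed (use that in \<open>auto simp: U_def\<close>)
    have g0: "\<eta> x = g 0 x" if x: "x \<in> U" for x
    proof -
      consider "x < r j" | "x = r j" | "r j < x" by linarith
      then show ?thesis
      proof cases
        case 1
        then have "x \<in> knot_interval n r (j - 1)" using x j
          by (auto simp: U_def knot_interval_def split: if_splits)
        then show ?thesis using \<eta>E[of "j - 1" x] 1 j by (simp add: g_def)
      next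
        case 2
        then show ?thesis using \<eta>r[OF j] match[OF j, of 0] by (simp add: g_def)
      next
        case 3
        then have "x \<in> knot_interval n r j" using x j
          by (auto simp: U_def knot_interval_def split: if_splits)
        then show ?thesis using \<eta>E[of j x] 3 j by (simp add: g_def)
      qed
    qed
    \<comment> \<open>Gluing the derivative of order \<open>i\<close> requires matching at orders
      \<open>i\<close> and \<open>Suc i\<close>; with matching up to order 2 this reaches exactly
      \<open>i < 2\<close>.\<close>
    have dg: "(g i has_vector_derivative g (Suc i) x) (at x)" if "i < 2" "x \<in> U" for i x
      unfolding g_def[abs_def]
      by (rule has_vector_derivative_glue) (use dE Upos match j that in auto)
    have "continuous_on U (g 2)"
    proof -
      have cE: "continuous_on T (E m i)" if "T \<subseteq> U" for T m i
        using dE has_vector_derivative_continuous that Upos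
        by (metis continuous_at_imp_continuous_on subsetD)
      show ?thesis
        unfolding g_def[abs_def]
        by (rule continuous_on_cases_le[where h = "\<lambda>x. x", OF cE cE])
          (use match[OF j, of 2] in auto)
    qed
    moreover have "nth_vderiv 2 \<eta> x = g 2 x" if "x \<in> U" for x
      by (rule nth_vderiv_chain[OF oU, where g = g and m = 2]) (use g0 dg that in auto)
    ultimately have "continuous_on U (nth_vderiv 2 \<eta>)"
      by (simp cong: continuous_on_cong)
    moreover have "times_differentiable_on 2 \<eta> U"
      by (rule times_differentiable_on_chain[OF oU, where g = g]) (use g0 dg in auto)
    ultimately show ?thesis using oU rU unfolding C2_at_def by blast
  qed
  \<comment> \<open>Near 0 only the powers \<kappa> and \<kappa> + 2 occur, both positive.\<close>
  have lim: "(\<eta> \<longlongrightarrow> 0) (at_right 0)"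
  proof -
    have "((\<lambda>x. C 0 0 * of_real (x powr \<kappa>) + C 0 1 * of_real (x powr (\<kappa> + 2)))
        \<longlongrightarrow> C 0 0 * of_real 0 + C 0 1 * of_real 0) (at_right 0)"
      using \<kappa> by (intro tendsto_intros tendsto_zero_powrI)
        (auto simp: eventually_at_right_less eventually_at intro!: exI[of _ 1])
    moreover have "eventually (\<lambda>x. x \<in> {0<..<r 1}) (at_right 0)"
      using r1 by (rule eventually_at_right_real)
    then have "eventually (\<lambda>x. C 0 0 * of_real (x powr \<kappa>) + C 0 1 * of_real (x powr (\<kappa> + 2)) = \<eta> x)
        (at_right 0)"
      by eventually_elim (use C \<eta>E[of 0] n in
          \<open>auto simp: knot_interval_def E_def ecomb_def sum_lessThan_4 spline_coeffs_def eb_def\<close>)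
    ultimately show ?thesis using tendsto_cong by fastforce
  qed
  have "\<eta> \<in> beppo_levi_splines k n r"
    unfolding beppo_levi_splines_def mem_Collect_eq
  proof (intro conjI ballI)
    show "\<eta> \<in> extensional {0..}" by (auto simp: extensional_def \<eta>_def)
    show "\<eta> 0 = 0" by (simp add: \<eta>_def)
    then show "(\<eta> \<longlongrightarrow> \<eta> 0) (at_right 0)" using lim by simp
    show "C2_at \<eta> (r j)" if "j \<in> {1..n}" for j using c2[of j] that by simp
    have I0: "knot_interval n r 0 = {0<..<r 1}" using n by (simp add: knot_interval_cases)
    have In: "knot_interval n r n = {r n<..}" using n by (simp add: knot_interval_cases)
    have Ij: "knot_interval n r j = {r j<..<r (j + 1)}" if "j \<in> {1..<n}" for j
      using that by (simp add: knot_interval_cases)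
    show "times_differentiable_on 2 \<eta> {0<..<r 1}" using I[of 0 2] by (simp add: I0)
    show "times_differentiable_on 2 \<eta> {r n<..}" using I[of n 2] by (simp add: In)
    show "times_differentiable_on 4 \<eta> {r j<..<r (j + 1)}" if "j \<in> {1..<n}" for j
      using I[of j 4] that unfolding Ij[OF that] by simp
    show "G_op k \<eta> x = 0" if "x \<in> {0<..<r 1}" for x
      by (rule G_op_ecomb[where c = "C 0"])
        (use that C D[of 0 x, unfolded I0] in \<open>auto simp: spline_coeffs_def E_def \<kappa>_def\<close>)
    show "R_op k \<eta> x = 0" if "x \<in> {r n<..}" for x
      by (rule R_op_ecomb[where c = "C n"])
        (use that C D[of n x, unfolded In] pos[of n] n in
          \<open>auto simp: spline_coeffs_def E_def \<kappa>_def\<close>)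
    show "L_op k \<eta> x = 0" if "j \<in> {1..<n}" "x \<in> {r j<..<r (j + 1)}" for j x
      by (rule L_op_ecomb[where c = "C j"])
        (use that D[of j x, unfolded Ij[OF that(1)]] pos[of j] in
          \<open>auto simp: E_def \<kappa>_def\<close>)
  qed
  moreover have "\<eta> (r j) = ecomb \<kappa> (C j) (r j)" if "1 \<le> j" "j \<le> n" for j
    using \<eta>r[OF that] by (simp add: E_def)
  ultimately show ?thesis using that unfolding \<kappa>_def by blast
qed

section \<open>Existence and uniqueness of the interpolating spline\<close>

theorem theorem2:
  fixes n :: nat and r :: "nat \<Rightarrow> real" and \<nu> :: "nat \<Rightarrow> real" and k :: int
  assumes "n \<ge> 2" and "0 < r 1" and "strict_mono_on {1..n} r" and "k \<noteq> 0"
  shows "\<exists>!\<sigma>. \<sigma> \<in> beppo_levi_splines k n r \<and> (\<forall>j\<in>{1..n}. \<sigma> (r j) = complex_of_real (\<nu> j))"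
proof -
  define \<kappa> where "\<kappa> = \<bar>real_of_int k\<bar>"
  have \<kappa>: "1 \<le> \<kappa>" using assms(4) unfolding \<kappa>_def by linarith
  have r: "r j < r (Suc j)" if "1 \<le> j" "j < n" for j
    using assms(3) that by (auto intro: strict_mono_onD)
  obtain C where C: "spline_coeffs \<kappa> n r C"
    "\<And>j. 1 \<le> j \<Longrightarrow> j \<le> n \<Longrightarrow> ecomb \<kappa> (C j) (r j) = complex_of_real (\<nu> j)"
    using spline_coeffs_exist[OF \<kappa> assms(1,2) r, of "\<lambda>j. complex_of_real (\<nu> j)"] by metis
  obtain \<eta> where "\<eta> \<in> beppo_levi_splines k n r"
    "\<And>j. 1 \<le> j \<Longrightarrow> j \<le> n \<Longrightarrow> \<eta> (r j) = ecomb \<kappa> (C j) (r j)"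
    using coeffs_imp_spline[OF assms(4,1,2) r C(1)[unfolded \<kappa>_def]] unfolding \<kappa>_def by metis
  then have "\<eta> \<in> beppo_levi_splines k n r \<and> (\<forall>j\<in>{1..n}. \<eta> (r j) = complex_of_real (\<nu> j))"
    using C(2) by simp
  moreover have "\<sigma> = \<tau>"
    if \<sigma>: "\<sigma> \<in> beppo_levi_splines k n r" "\<forall>j\<in>{1..n}. \<sigma> (r j) = complex_of_real (\<nu> j)"
      and \<tau>: "\<tau> \<in> beppo_levi_splines k n r" "\<forall>j\<in>{1..n}. \<tau> (r j) = complex_of_real (\<nu> j)"
    for \<sigma> \<tau>
  proof -
    obtain A where A: "spline_coeffs \<kappa> n r A"
      "\<And>j x. j \<le> n \<Longrightarrow> x \<in> knot_interval n r j \<Longrightarrow> \<sigma> x = ecomb \<kappa> (A j) x"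
      "\<And>j. 1 \<le> j \<Longrightarrow> j \<le> n \<Longrightarrow> \<sigma> (r j) = ecomb \<kappa> (A j) (r j)"
      using spline_imp_coeffs[OF assms(4,1,2) r \<sigma>(1)] unfolding \<kappa>_def by metis
    obtain B where B: "spline_coeffs \<kappa> n r B"
      "\<And>j x. j \<le> n \<Longrightarrow> x \<in> knot_interval n r j \<Longrightarrow> \<tau> x = ecomb \<kappa> (B j) x"
      "\<And>j. 1 \<le> j \<Longrightarrow> j \<le> n \<Longrightarrow> \<tau> (r j) = ecomb \<kappa> (B j) (r j)"
      using spline_imp_coeffs[OF assms(4,1,2) r \<tau>(1)] unfolding \<kappa>_def by metis
    have "ecomb \<kappa> (A j) (r j) = ecomb \<kappa> (B j) (r j)" if "1 \<le> j" "j \<le> n" for j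
      using A(3)[OF that] B(3)[OF that] \<sigma>(2) \<tau>(2) that by simp
    then have "A j i = B j i" if "j \<le> n" "i < 4" for j i
      using spline_coeffs_unique[OF \<kappa> assms(1,2) r A(1) B(1) _ that] by blast
    then have eq: "ecomb \<kappa> (A j) x = ecomb \<kappa> (B j) x" if "j \<le> n" for j x
      using that by (simp add: ecomb_def)
    \<comment> \<open>Extensional functions need comparing only on the half-line: at 0 both vanish
      by definition, at the knots both take the prescribed values, and elsewhere equal coefficients
      decide.\<close>
    show ?thesis
    proof (rule extensionalityI[of _ "{0..}"])
      fix x :: real assume "x \<in> {0..}"
      then consider "x = 0" | "0 < x" by force
      then show "\<sigma> x = \<tau> x"
      proof cases
        case 1
        then show ?thesis using \<sigma>(1) \<tau>(1) by (simp add: beppo_levi_splines_def)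
      next
        case 2
        then show ?thesis
        proof (rule positive_cases_knot[of x n r])
          show "\<sigma> x = \<tau> x" if "j \<le> n" "x \<in> knot_interval n r j" for j
            using A(2) B(2) eq that by simp
          show "\<sigma> x = \<tau> x" if "1 \<le> j" "j \<le> n" "x = r j" for j
            using \<sigma>(2) \<tau>(2) that by simp
        qed
      qed
    qed (use \<sigma>(1) \<tau>(1) in \<open>auto simp: beppo_levi_splines_def\<close>)
  qed
  ultimately show ?thesis by blast
qed

end
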